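(* Let $f_1(\Theta)=\frac{2\Theta^2+2\Theta}{\Theta^2+\Theta-2}$ and $f_2(\Theta)=\Theta+1-\frac{\Theta-1}{3\Theta+3}$, and let $\Theta^*$ be the only positive real solution of $f_1(\Theta)=f_2(\Theta)$ (so $\Theta^*\approx 2.0526$). For open, non-preemptive online Dial-a-Ride on the line (with arbitrary server capacity $c\in\mathbb{N}\cup\{\infty\}$), the competitive ratio of $\textsc{Smartstart}_{\Theta^*}$ is exactly $$\rho^*:=f_1(\Theta^* )=f_2(\Theta^* )\approx 2.93768 .$$ For every other $\Theta>1$ with $\Theta\neq\Theta^*$, the competitive ratio of $\textsc{Smartstart}_\Theta$ is larger than $\rho^*$.
   Context: Open, non-preemptive Dial-a-Ride on the real line. An instance is a finite nonempty set of requests $\sigma=\{\sigma_1,\dots,\sigma_n\}$ with $\sigma_i=(a_i,b_i;r_i)$, $a_i,b_i\in\mathbb{R}$, $r_i\ge 0$: request $\sigma_i$ appears at time $r_i$ at position $a_i$ and must be transported to position $b_i$. A single server of capacity $c\in\mathbb{N}\cup\{\infty\}$ starts at the origin at time $0$, moves with unit speed (it may also wait), cannot pick up a request before its release time, never carries more than $c$ requests at once, and a request that was picked up stays on board until it is delivered at its destination (non-preemptive). In the open version the server need not return to the origin. The length of a schedule is the time from its start until its last request is delivered (waiting included). $L(t,p,R)$ is the length of a shortest schedule that starts at position $p$ at time $t$ and serves all requests in $R\subseteq\sigma$ respecting release times. The offline optimum is $\textsc{Opt}(\sigma):=L(0,0,\sigma)$. In the online problem, $\sigma_i$ is revealed only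 at time $r_i$, and the number of requests is not known in advance. Algorithm $\textsc{Smartstart}_\Theta$ (parameter $\Theta>1$): let $R_t$ be the set of requests with release time at most $t$ that have not been served by time $t$. Starting at position $p_1=0$ at time $0$, for $j=1,2,\dots$: whenever the server is idle at position $p_j$ at current time $t$, it waits until there are unserved released requests and then until the earliest time $t_j:=\min\{t'\ge t: R_{t'}\ne\emptyset,\ t'\ge L(t',p_j,R_{t'})/(\Theta-1)\}$. At time $t_j$ it starts a shortest schedule $S_j$ serving $R_{t_j}$ from $p_j$, and executes it while ignoring all newly appearing requests; it ends at position $p_{j+1}$, the position where the last request of $S_j$ is delivered. $\textsc{Smartstart}(\sigma)$ denotes the time at which all requests of $\sigma$ have been served. The competitive ratio of $\textsc{Smartstart}_\Theta$ is the infimum of all $\rho$ with $\textsc{Smartstart}(\sigma)\le\rho\,\textsc{Opt}(\sigma)$ for all instances $\sigma$. *)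

theory Defs
  imports Complex_Main "HOL-Library.Extended_Nat" "HOL-Library.Extended_Real"
begin

datatype request = Request (origin: real) (destination: real) (release: real)

definition dar_instance :: "request set \<Rightarrow> bool" where
  "dar_instance \<sigma> \<longleftrightarrow> finite \<sigma> \<and> \<sigma> \<noteq> {} \<and> (\<forall>r\<in>\<sigma>. 0 \<le> release r)"

datatype action = Pickup request | Deliver request

fun site :: "action \<Rightarrow> real" where
  "site (Pickup r) = origin r"
| "site (Deliver r) = destination r"

text \<open>
  A schedule is the chronological list of the pickups and deliveries that the server performs,
  each with its time. Between two consecutive stops the server drives at unit speed and waits for
  the rest of the time, so the elapsed time has to be at least the distance. Pickups and
  deliveries take no time, and several of them may carry the same time stamp; the list then fixes
  their order.
\<close>

type_synonym schedule = "(real \<times> action) list"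

text \<open>
  In \<open>feasible c t p W B S\<close>, a server of capacity \<open>c\<close> is at position \<open>p\<close> at
  time \<open>t\<close>, the requests in \<open>B\<close> are on board, and those in \<open>W\<close> are still to
  be picked up. A request leaves \<open>B\<close> only through delivery at its destination
  (non-preemption).
\<close>

fun feasible ::
    "enat \<Rightarrow> real \<Rightarrow> real \<Rightarrow> request set \<Rightarrow> request set \<Rightarrow> schedule \<Rightarrow> bool" where
  "feasible c t p W B [] \<longleftrightarrow> W = {} \<and> B = {}"
| "feasible c t p W B ((u, Pickup r) # S) \<longleftrightarrow>
     t + \<bar>origin r - p\<bar> \<le> u \<and> r \<in> W \<and> release r \<le> u \<and> enat (card B + 1) \<le> c \<and>
     feasible c u (origin r) (W - {r}) (insert r B) S"
| "feasible c t p W B ((u, Deliver r) # S) \<longleftrightarrow>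
     t + \<bar>destination r - p\<bar> \<le> u \<and> r \<in> B \<and>
     feasible c u (destination r) W (B - {r}) S"

definition serves :: "enat \<Rightarrow> real \<Rightarrow> real \<Rightarrow> request set \<Rightarrow> schedule \<Rightarrow> bool" where
  "serves c t p R S \<longleftrightarrow> feasible c t p R {} S"

text \<open>The last stop of a schedule serving a nonempty set of requests is its last delivery.\<close>

definition sched_length :: "real \<Rightarrow> schedule \<Rightarrow> real" where
  "sched_length t S = (if S = [] then 0 else fst (last S) - t)"

definition end_position :: "real \<Rightarrow> schedule \<Rightarrow> real" where
  "end_position p S = (if S = [] then p else site (snd (last S)))"

definition shortest_schedule ::
    "enat \<Rightarrow> real \<Rightarrow> real \<Rightarrow> request set \<Rightarrow> schedule \<Rightarrow> bool" where
  "shortest_schedule c t p R S \<longleftrightarrow>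
     serves c t p R S \<and> (\<forall>S'. serves c t p R S' \<longrightarrow> sched_length t S \<le> sched_length t S')"

definition L :: "enat \<Rightarrow> real \<Rightarrow> real \<Rightarrow> request set \<Rightarrow> real" where
  "L c t p R = Inf {sched_length t S | S. serves c t p R S}"

definition Opt :: "enat \<Rightarrow> request set \<Rightarrow> real" where
  "Opt c \<sigma> = L c 0 0 \<sigma>"

definition pending :: "request set \<Rightarrow> request set \<Rightarrow> real \<Rightarrow> request set" where
  "pending \<sigma> D t = {r \<in> \<sigma> - D. release r \<le> t}"

definition start_time ::
    "enat \<Rightarrow> real \<Rightarrow> request set \<Rightarrow> request set \<Rightarrow> real \<Rightarrow> real \<Rightarrow> real" where
  "start_time c \<Theta> \<sigma> D t p =
     (LEAST t'. t \<le> t' \<and> pending \<sigma> D t' \<noteq> {} \<and> L c t' p (pending \<sigma> D t') / (\<Theta> - 1) \<le> t')"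

text \<open>
  \<open>smartstart_idle c \<Theta> \<sigma> t p D\<close>: on the instance \<open>\<sigma>\<close>, Smartstart can become idle
  at time \<open>t\<close> at position \<open>p\<close>, having served exactly the requests in \<open>D\<close>. This is
  a relation because the shortest schedule chosen by the algorithm need not be unique.
\<close>

inductive smartstart_idle ::
    "enat \<Rightarrow> real \<Rightarrow> request set \<Rightarrow> real \<Rightarrow> real \<Rightarrow> request set \<Rightarrow> bool"
  for c :: enat and \<Theta> :: real and \<sigma> :: "request set" where
  start: "smartstart_idle c \<Theta> \<sigma> 0 0 {}"
| step: "smartstart_idle c \<Theta> \<sigma> (t' + sched_length t' S) (end_position p S) (D \<union> R)"
    if "smartstart_idle c \<Theta> \<sigma> t p D" and "D \<noteq> \<sigma>"
      and "t' = start_time c \<Theta> \<sigma> D t p" and "R = pending \<sigma> D t'"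
      and "shortest_schedule c t' p R S"

text \<open>
  \<open>A\<close> maps every instance to a completion time of Smartstart on it, for some way of choosing
  among the shortest schedules.
\<close>

definition smartstart :: "enat \<Rightarrow> real \<Rightarrow> (request set \<Rightarrow> real) \<Rightarrow> bool" where
  "smartstart c \<Theta> A \<longleftrightarrow> (\<forall>\<sigma>. dar_instance \<sigma> \<longrightarrow> (\<exists>p. smartstart_idle c \<Theta> \<sigma> (A \<sigma>) p \<sigma>))"

text \<open>The value is \<open>\<infinity>\<close> if no finite ratio is guaranteed.\<close>

definition competitive_ratio :: "enat \<Rightarrow> (request set \<Rightarrow> real) \<Rightarrow> ereal" where
  "competitive_ratio c A =
     Inf {ereal \<rho> | \<rho>. \<forall>\<sigma>. dar_instance \<sigma> \<longrightarrow> A \<sigma> \<le> \<rho> * Opt c \<sigma>}"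

definition f1 :: "real \<Rightarrow> real" where
  "f1 \<Theta> = (2 * \<Theta>^2 + 2 * \<Theta>) / (\<Theta>^2 + \<Theta> - 2)"

definition f2 :: "real \<Rightarrow> real" where
  "f2 \<Theta> = \<Theta> + 1 - (\<Theta> - 1) / (3 * \<Theta> + 3)"

definition theta_star :: real where
  "theta_star = (THE \<Theta>. 0 < \<Theta> \<and> f1 \<Theta> = f2 \<Theta>)"

definition rho_star :: real where
  "rho_star = f1 theta_star"

end

theory Submission
  imports Defs
begin

text \<open>
  Upper bound. Let \<open>C\<close> be the completion time of an offline schedule, \<open>t\<close> the start time of the
  last but one schedule of Smartstart, \<open>q\<close> the starting point of the last one, and \<open>a\<close> the place of
  the offline server's first pickup among the final requests, which happens after time \<open>t\<close>. The
  last schedule costs at most a move from \<open>q\<close> to \<open>a\<close> plus the rest of the offline schedule. The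
  offline server visits \<open>q\<close> too. If Smartstart waits before the last schedule, the two orders of
  \<open>a\<close> and \<open>q\<close> give \<open>f1\<close>. Otherwise the critical case is that the offline server visits \<open>q\<close>
  early. Then the last but one batch was released early and started from near the origin. Its
  schedule ends at \<open>q\<close> after visiting the point \<open>z\<close> where the offline server finishes this batch,
  and comparing the two ways of serving the batch gives \<open>f2\<close>.

  Lower bounds. A geometric sequence of point requests leads the server to \<open>T - 1\<close> at time \<open>T\<close>,
  where \<open>T = \<Theta>^m\<close>, and one more to some \<open>P\<close>, while the offline server is at \<open>-T\<close>. Requests
  that appear just after time \<open>T\<close> then force the online server back to \<open>-T\<close>: either they must be
  carried to the right from there, or the server ends there while the offline server is far to the
  right. Letting \<open>m\<close> grow yields \<open>f1\<close> and \<open>f2\<close>.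
\<close>

fun request_of :: "action \<Rightarrow> request" where
  "request_of (Pickup r) = r"
| "request_of (Deliver r) = r"

subsection \<open>Feasible schedules\<close>

lemma feasible_start:
  "feasible c t p W B S \<Longrightarrow> x \<in> set S \<Longrightarrow> t + \<bar>site (snd x) - p\<bar> \<le> fst x"
proof (induction c t p W B S rule: feasible.induct)
  case (2 c t p W B u r S)
  show ?case
  proof (cases "x = (u, Pickup r)")
    case False
    then have "u + \<bar>site (snd x) - origin r\<bar> \<le> fst x" using 2 by auto
    then show ?thesis using 2 by auto
  qed (use 2 in auto)
next
  case (3 c t p W B u r S)
  show ?case
  proof (cases "x = (u, Deliver r)")
    case False
    then have "u + \<bar>site (snd x) - destination r\<bar> \<le> fst x" using 3 by auto
    then show ?thesis using 3 by auto
  qed (use 3 in auto)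
qed auto

text \<open>For the head of the list this is \<open>feasible_start\<close> applied to the rest,
  which turns unit speed between neighbours into unit speed between any two stops.\<close>

lemma feasible_sorted:
  "feasible c t p W B S \<Longrightarrow>
    sorted_wrt (\<lambda>x y. \<bar>site (snd y) - site (snd x)\<bar> \<le> fst y - fst x) S"
proof (induction c t p W B S rule: feasible.induct)
  case (2 c t p W B u r S)
  then show ?case using feasible_start[of c u "origin r" "W - {r}" "insert r B" S] by fastforce
next
  case (3 c t p W B u r S)
  then show ?case using feasible_start[of c u "destination r" W "B - {r}" S] by fastforce
qed auto

lemma feasible_dist:
  assumes "feasible c t p W B S" "x \<in> set S" "y \<in> set S"
  shows "\<bar>site (snd x) - site (snd y)\<bar> \<le> \<bar>fst x - fst y\<bar>"
proof -
  obtain i j where ij: "i < length S" "j < length S" "x = S ! i" "y = S ! j"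
    using assms(2,3) by (auto simp: in_set_conv_nth)
  have *: "\<bar>site (snd (S ! l)) - site (snd (S ! k))\<bar> \<le> fst (S ! l) - fst (S ! k)"
    if "k < l" "l < length S" for k l
    using feasible_sorted[OF assms(1)] that by (auto simp: sorted_wrt_iff_nth_less)
  show ?thesis
    using *[of i j] *[of j i] ij by (cases i j rule: linorder_cases) auto
qed

lemma feasible_le_last:
  assumes "feasible c t p W B S" "x \<in> set S"
  shows "fst x \<le> fst (last S)"
proof -
  obtain i where i: "i < length S" "x = S ! i"
    using assms(2) by (auto simp: in_set_conv_nth)
  have "\<bar>site (snd (S ! l)) - site (snd (S ! k))\<bar> \<le> fst (S ! l) - fst (S ! k)"
    if "k < l" "l < length S" for k l
    using feasible_sorted[OF assms(1)] that by (auto simp: sorted_wrt_iff_nth_less)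
  from this[of i "length S - 1"] show ?thesis
    using i by (cases "i < length S - 1"; cases "i = length S - 1"; cases "S = []")
      (auto simp: last_conv_nth)
qed

lemma feasible_hd_le:
  assumes "feasible c t p W B S" "x \<in> set S"
  shows "fst (hd S) \<le> fst x"
  using feasible_sorted[OF assms(1)] assms(2) by (cases S) fastforce+

lemma feasible_deliver:
  "feasible c t p W B S \<Longrightarrow> r \<in> W \<union> B \<Longrightarrow> \<exists>v. (v, Deliver r) \<in> set S"
  by (induction c t p W B S rule: feasible.induct) fastforce+

lemma feasible_pickup:
  "feasible c t p W B S \<Longrightarrow> r \<in> W \<Longrightarrow>
    \<exists>u v. (u, Pickup r) \<in> set S \<and> (v, Deliver r) \<in> set S \<and> release r \<le> u \<and> u \<le> v"
proof (induction c t p W B S rule: feasible.induct)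
  case (2 c t p W B u r' S)
  show ?case
  proof (cases "r = r'")
    case True
    obtain v where v: "(v, Deliver r) \<in> set S"
      using feasible_deliver[of c u "origin r'" "W - {r'}" "insert r' B" S r] 2 True by auto
    have "u \<le> v" using feasible_start[of c u "origin r'" "W - {r'}" "insert r' B" S] v 2 by fastforce
    then show ?thesis using v True 2 by auto
  qed (use 2 in fastforce)
qed fastforce+

lemma feasible_release:
  "feasible c t p W B S \<Longrightarrow> (u, Pickup r) \<in> set S \<Longrightarrow> release r \<le> u"
  by (induction c t p W B S rule: feasible.induct) auto

lemma feasible_request_of:
  "feasible c t p W B S \<Longrightarrow> x \<in> set S \<Longrightarrow> request_of (snd x) \<in> W \<union> B"
  by (induction c t p W B S rule: feasible.induct) fastforce+

lemma feasible_last: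
  "feasible c t p W B S \<Longrightarrow> S \<noteq> [] \<Longrightarrow> \<exists>r \<in> W \<union> B. snd (last S) = Deliver r"
proof (induction c t p W B S rule: feasible.induct)
  case (2 c t p W B u r S)
  then show ?case by (cases "S = []") auto
next
  case (3 c t p W B u r S)
  then show ?case by (cases "S = []") auto
qed auto

lemma feasible_hd:
  "feasible c t p W {} S \<Longrightarrow> S \<noteq> [] \<Longrightarrow> \<exists>r \<in> W. snd (hd S) = Pickup r"
proof -
  assume "feasible c t p W {} S" "S \<noteq> []"
  then obtain u a S' where "S = (u, a) # S'" by (cases S) auto
  then show ?thesis using \<open>feasible c t p W {} S\<close> by (cases a) auto
qed

lemma feasible_weaken:
  "feasible c u q W B S \<Longrightarrow> t + \<bar>q - p\<bar> \<le> u \<Longrightarrow> feasible c t p W B S"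
  by (cases "(c, u, q, W, B, S)" rule: feasible.cases) auto

text \<open>Leaving out stops only lowers the load, and by the triangle inequality the direct way to
  the next remaining stop is no longer than the detour (\<open>feasible_weaken\<close>).\<close>

lemma feasible_filter:
  "feasible c t p W B S \<Longrightarrow> finite B \<Longrightarrow>
    feasible c t p (W \<inter> R) (B \<inter> R) (filter (\<lambda>x. request_of (snd x) \<in> R) S)"
proof (induction c t p W B S rule: feasible.induct)
  case (2 c t p W B u r S)
  have IH: "feasible c u (origin r) ((W - {r}) \<inter> R) (insert r B \<inter> R)
      (filter (\<lambda>x. request_of (snd x) \<in> R) S)"
    using 2 by auto
  show ?case
  proof (cases "r \<in> R")
    case True
    have "card (B \<inter> R) \<le> card B" using 2 by (simp add: card_mono)
    then have "enat (card (B \<inter> R) + 1) \<le> enat (card B + 1)" by simp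
    then have "enat (card (B \<inter> R) + 1) \<le> c" using 2 order_trans[of _ "enat (card B + 1)" c] by simp
    moreover have "(W - {r}) \<inter> R = W \<inter> R - {r}" "insert r B \<inter> R = insert r (B \<inter> R)"
      using True by auto
    ultimately show ?thesis using 2 True IH by auto
  next
    case False
    moreover have "(W - {r}) \<inter> R = W \<inter> R" "insert r B \<inter> R = B \<inter> R" using False by auto
    ultimately show ?thesis using 2 IH by (auto intro: feasible_weaken)
  qed
next
  case (3 c t p W B u r S)
  have IH: "feasible c u (destination r) (W \<inter> R) ((B - {r}) \<inter> R)
      (filter (\<lambda>x. request_of (snd x) \<in> R) S)"
    using 3 by auto
  show ?case
  proof (cases "r \<in> R")
    case True
    have "(B - {r}) \<inter> R = B \<inter> R - {r}" by auto
    then show ?thesis using 3 True IH by auto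
  next
    case False
    then have "(B - {r}) \<inter> R = B \<inter> R" by auto
    then show ?thesis using 3 IH False by (auto intro: feasible_weaken)
  qed
qed auto

lemma feasible_shift:
  "feasible c t p W B S \<Longrightarrow> \<forall>r\<in>W. release r \<le> t + d \<Longrightarrow>
    feasible c (t + d) p W B (map (\<lambda>x. (fst x + d, snd x)) S)"
proof (induction c t p W B S rule: feasible.induct)
  case (2 c t p W B u r S)
  have "\<forall>r'\<in>W - {r}. release r' \<le> u + d" using 2 by fastforce
  then show ?case using 2 by auto
next
  case (3 c t p W B u r S)
  have "\<forall>r'\<in>W. release r' \<le> u + d" using 3 by fastforce
  then show ?case using 3 by auto
qed auto

subsection \<open>Shortest schedules\<close>

text \<open>The fastest timing of a fixed order of actions. It reduces the search for a shortest
  schedule to finitely many candidates.\<close>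

fun earliest :: "real \<Rightarrow> real \<Rightarrow> action list \<Rightarrow> schedule" where
  "earliest t p [] = []"
| "earliest t p (Pickup r # as) =
     (let u = max (t + \<bar>origin r - p\<bar>) (release r) in (u, Pickup r) # earliest u (origin r) as)"
| "earliest t p (Deliver r # as) =
     (let u = t + \<bar>destination r - p\<bar> in (u, Deliver r) # earliest u (destination r) as)"

lemma earliest_Nil_iff [simp]: "earliest t p as = [] \<longleftrightarrow> as = []"
  by (cases "(t, p, as)" rule: earliest.cases) (auto simp: Let_def)

text \<open>The start time \<open>t'\<close> is generalized because the time gained at one stop is
  passed on to the next.\<close>

lemma feasible_earliest:
  "feasible c t p W B S \<Longrightarrow> t' \<le> t \<Longrightarrow>
    feasible c t' p W B (earliest t' p (map snd S)) \<and>
    (S \<noteq> [] \<longrightarrow> fst (last (earliest t' p (map snd S))) \<le> fst (last S))"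
proof (induction c t p W B S arbitrary: t' rule: feasible.induct)
  case (2 c t p W B u r S)
  define u' where "u' = max (t' + \<bar>origin r - p\<bar>) (release r)"
  have "u' \<le> u" using 2 by (auto simp: u'_def)
  then show ?case
    using "2.IH"[of u'] "2.prems" by (auto simp: Let_def u'_def[symmetric]) (auto simp: u'_def)
next
  case (3 c t p W B u r S)
  define u' where "u' = t' + \<bar>destination r - p\<bar>"
  have "u' \<le> u" using 3 by (auto simp: u'_def)
  then show ?case
    using "3.IH"[of u'] "3.prems" by (auto simp: Let_def u'_def[symmetric])
qed auto

text \<open>Each waiting request accounts for two stops, each one on board for one. Hence only
  finitely many orders of actions are possible.\<close>

lemma feasible_length:
  "feasible c t p W B S \<Longrightarrow> finite W \<Longrightarrow> finite B \<Longrightarrow> length S \<le> 2 * card W + card B"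
proof (induction c t p W B S rule: feasible.induct)
  case (2 c t p W B u r S)
  have "card W = Suc (card (W - {r}))" using 2 card_Suc_Diff1[of W r] by simp
  moreover have "card (insert r B) \<le> Suc (card B)" using 2 by (simp add: card_insert_if)
  moreover have "length S \<le> 2 * card (W - {r}) + card (insert r B)" using 2 by auto
  ultimately show ?case by simp
next
  case (3 c t p W B u r S)
  have "card B = Suc (card (B - {r}))" using 3 card_Suc_Diff1[of B r] by simp
  moreover have "length S \<le> 2 * card W + card (B - {r})" using 3 by auto
  ultimately show ?case by simp
qed auto

lemma serves_Nil_iff: "serves c t p R [] \<longleftrightarrow> R = {}"
  by (auto simp: serves_def)

lemma sched_length_nonneg: "serves c t p R S \<Longrightarrow> 0 \<le> sched_length t S"
  using feasible_start[of c t p R "{}" S "last S"]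
  by (auto simp: serves_def sched_length_def)

lemma bdd_below_lengths: "bdd_below {sched_length t S | S. serves c t p R S}"
  by (rule bdd_belowI[of _ 0]) (auto intro: sched_length_nonneg)

lemma L_le: "serves c t p R S \<Longrightarrow> L c t p R \<le> sched_length t S"
  unfolding L_def by (rule cInf_lower[OF _ bdd_below_lengths]) auto

text \<open>Completion time if the requests are carried one at a time in list order, which any
  capacity of at least 1 allows. It yields explicit upper bounds on \<open>L\<close> and
  \<open>Opt\<close>.\<close>

fun finish :: "real \<Rightarrow> real \<Rightarrow> request list \<Rightarrow> real" where
  "finish t p [] = t"
| "finish t p (r # rs) =
     finish (max (t + \<bar>origin r - p\<bar>) (release r) + \<bar>destination r - origin r\<bar>) (destination r) rs"

lemma serves_finish:
  assumes "1 \<le> c" "distinct rs"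
  shows "\<exists>S. serves c t p (set rs) S \<and> sched_length t S = finish t p rs - t"
  using assms(2)
proof (induction rs arbitrary: t p)
  case Nil
  then show ?case by (intro exI[of _ "[]"]) (simp add: serves_def sched_length_def)
next
  case (Cons r rs)
  define u where "u = max (t + \<bar>origin r - p\<bar>) (release r)"
  define v where "v = u + \<bar>destination r - origin r\<bar>"
  obtain S where S: "serves c v (destination r) (set rs) S"
      "sched_length v S = finish v (destination r) rs - v"
    using Cons by fastforce
  have "insert r (set rs) - {r} = set rs" using Cons.prems by auto
  then have "serves c t p (set (r # rs)) ((u, Pickup r) # (v, Deliver r) # S)"
    using S(1) assms(1) by (auto simp: serves_def u_def v_def one_enat_def)
  moreover have "sched_length t ((u, Pickup r) # (v, Deliver r) # S) = finish t p (r # rs) - t"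
    using S by (auto simp: sched_length_def u_def v_def split: if_splits)
  ultimately show ?case by blast
qed

lemma L_le_finish: "1 \<le> c \<Longrightarrow> distinct rs \<Longrightarrow> L c t p (set rs) \<le> finish t p rs - t"
  using serves_finish L_le by metis

lemma serves_exists:
  assumes "1 \<le> c" "finite R"
  shows "\<exists>S. serves c t p R S"
proof -
  obtain rs where "distinct rs" "set rs = R" using finite_distinct_list[OF assms(2)] by auto
  then show ?thesis using serves_finish[OF assms(1)] by blast
qed

lemma le_L:
  assumes "1 \<le> c" "finite R" "\<And>S. serves c t p R S \<Longrightarrow> x \<le> sched_length t S"
  shows "x \<le> L c t p R"
  unfolding L_def using serves_exists[OF assms(1,2)] assms(3)
  by (intro cInf_greatest) auto

text \<open>The same schedule begun at \<open>t'\<close> keeps its length, since everything has been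
  released by then.\<close>

lemma L_shift:
  assumes "1 \<le> c" "finite R" "\<forall>r\<in>R. release r \<le> t'"
  shows "L c t' p R \<le> L c t p R"
proof (rule le_L[OF assms(1,2)])
  fix S assume S: "serves c t p R S"
  let ?S = "map (\<lambda>x. (fst x + (t' - t), snd x)) S"
  have "serves c t' p R ?S"
    using feasible_shift[of c t p R "{}" S "t' - t"] S assms(3) by (auto simp: serves_def)
  moreover have "sched_length t' ?S = sched_length t S"
    by (auto simp: sched_length_def last_map)
  ultimately show "L c t' p R \<le> sched_length t S" using L_le by metis
qed

lemma L_eq:
  assumes "1 \<le> c" "finite R" "\<forall>r\<in>R. release r \<le> t" "\<forall>r\<in>R. release r \<le> t'"
  shows "L c t p R = L c t' p R"
  using L_shift[OF assms(1,2)] assms(3,4) by (intro antisym) auto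

lemma shortest_schedule_L:
  assumes "shortest_schedule c t p R S"
  shows "sched_length t S = L c t p R"
  using assms unfolding L_def shortest_schedule_def
  by (intro cInf_eq_minimum[symmetric]) auto

text \<open>Every schedule is matched by the earliest timing of its actions, and the bound on the
  number of stops leaves finitely many of these to compare.\<close>

lemma shortest_schedule_exists:
  assumes "1 \<le> c" "finite R"
  shows "\<exists>S. shortest_schedule c t p R S"
proof -
  define X where "X = {S. serves c t p R S \<and> S \<in> earliest t p `
    {as. set as \<subseteq> Pickup ` R \<union> Deliver ` R \<and> length as \<le> 2 * card R}}"
  have key: "\<exists>S'\<in>X. sched_length t S' \<le> sched_length t S" if S: "serves c t p R S" for S
  proof -
    have f: "feasible c t p R {} S" using S by (simp add: serves_def)
    have "a \<in> Pickup ` R \<union> Deliver ` R" if "a \<in> snd ` set S" for a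
      using that feasible_request_of[OF f] by (cases a) fastforce+
    then have "set (map snd S) \<subseteq> Pickup ` R \<union> Deliver ` R" by auto
    moreover have "length (map snd S) \<le> 2 * card R" using feasible_length[OF f assms(2)] by simp
    ultimately have "earliest t p (map snd S) \<in> X"
      using feasible_earliest[OF f, of t] by (auto simp: serves_def X_def)
    moreover have "sched_length t (earliest t p (map snd S)) \<le> sched_length t S"
      using feasible_earliest[OF f, of t] by (auto simp: sched_length_def)
    ultimately show ?thesis by blast
  qed
  have "finite {as. set as \<subseteq> Pickup ` R \<union> Deliver ` R \<and> length as \<le> 2 * card R}"
    using assms(2) by (intro finite_lists_length_le) simp
  then have "finite X"
    by (rule finite_subset[OF _ finite_imageI[of _ "earliest t p"], rotated]) (auto simp: X_def)
  moreover have "X \<noteq> {}" using serves_exists[OF assms, of t p] key by blast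
  ultimately obtain S where "S \<in> X" "\<forall>S'\<in>X. sched_length t S \<le> sched_length t S'"
    using arg_min_if_finite(1)[of X "sched_length t"] arg_min_least[of X _ "sched_length t"]
    by blast
  then have "shortest_schedule c t p R S"
    unfolding shortest_schedule_def using key X_def
    by (metis (no_types, lifting) mem_Collect_eq order_trans)
  then show ?thesis ..
qed

lemma serves_facts:
  assumes "serves c t p R S" "x \<in> set S"
  shows "t + \<bar>site (snd x) - p\<bar> \<le> fst x"
    and "fst x \<le> t + sched_length t S"
    and "y \<in> set S \<Longrightarrow> \<bar>site (snd x) - site (snd y)\<bar> \<le> \<bar>fst x - fst y\<bar>"
  using feasible_start feasible_dist feasible_le_last[of c t p R "{}" S x] assms
  by (auto simp: serves_def sched_length_def)

lemma serves_pickup: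
  assumes "serves c t p R S" "r \<in> R"
  obtains u v where "(u, Pickup r) \<in> set S" "(v, Deliver r) \<in> set S" "release r \<le> u" "u \<le> v"
  using feasible_pickup assms unfolding serves_def by metis

lemma serves_last:
  assumes "serves c t p R S" "R \<noteq> {}"
  obtains r where "r \<in> R" "(t + sched_length t S, Deliver r) \<in> set S"
    "end_position p S = destination r"
proof -
  have "S \<noteq> []" using assms serves_Nil_iff by auto
  then obtain r where "r \<in> R" "snd (last S) = Deliver r"
    using assms feasible_last[of c t p R "{}" S] by (auto simp: serves_def)
  moreover from this have "(t + sched_length t S, Deliver r) = last S"
    using \<open>S \<noteq> []\<close> by (simp add: sched_length_def prod_eq_iff)
  ultimately show ?thesis
    using that \<open>S \<noteq> []\<close> by (auto simp: end_position_def)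
qed

text \<open>Strip a schedule for \<open>\<sigma>\<close> of all stops not concerning \<open>R\<close> and shift it in time: after a
  move to its first pickup it serves \<open>R\<close> from any position.\<close>

lemma L_le_restriction:
  assumes "1 \<le> c" "finite \<sigma>" "R \<subseteq> \<sigma>" "R \<noteq> {}" "serves c t0 p0 \<sigma> S"
  obtains r r' u v where "r \<in> R" "(u, Pickup r) \<in> set S" "r' \<in> R" "(v, Deliver r') \<in> set S"
    "\<And>x. x \<in> set S \<Longrightarrow> request_of (snd x) \<in> R \<Longrightarrow> u \<le> fst x \<and> fst x \<le> v"
    "\<And>t p. \<forall>r\<in>R. release r \<le> t \<Longrightarrow> L c t p R \<le> \<bar>origin r - p\<bar> + v - u"
proof -
  let ?S = "filter (\<lambda>x. request_of (snd x) \<in> R) S"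
  have f: "feasible c t0 p0 R {} ?S"
    using feasible_filter[of c t0 p0 \<sigma> "{}" S R] assms by (auto simp: serves_def Int_absorb1)
  then have ne: "?S \<noteq> []" using assms(4) by (metis feasible.simps(1))
  obtain r where r: "r \<in> R" "snd (hd ?S) = Pickup r" using feasible_hd[OF f ne] by auto
  obtain r' where r': "r' \<in> R" "snd (last ?S) = Deliver r'" using feasible_last[OF f ne] by auto
  define u v where "u = fst (hd ?S)" and "v = fst (last ?S)"
  have hd: "hd ?S = (u, Pickup r)" and la: "last ?S = (v, Deliver r')"
    using r r' by (auto simp: u_def v_def prod_eq_iff)
  have "(u, Pickup r) \<in> set S" "(v, Deliver r') \<in> set S"
    using hd_in_set[OF ne] last_in_set[OF ne] hd la by auto
  moreover have "u \<le> fst x \<and> fst x \<le> v" if "x \<in> set S" "request_of (snd x) \<in> R" for x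
    using feasible_hd_le[OF f, of x] feasible_le_last[OF f, of x] that by (auto simp: u_def v_def)
  moreover have "L c t p R \<le> \<bar>origin r - p\<bar> + v - u" if rel: "\<forall>r\<in>R. release r \<le> t" for t p
  proof -
    let ?d = "t + \<bar>origin r - p\<bar> - u"
    let ?S' = "map (\<lambda>x. (fst x + ?d, snd x)) ?S"
    obtain S2 where S2: "?S = (u, Pickup r) # S2" using ne hd by (metis list.collapse)
    have f0: "feasible c u (origin r) R {} ?S" using f by (simp add: S2)
    have "feasible c (u + ?d) (origin r) R {} ?S'"
      using rel by (intro feasible_shift[OF f0]) fastforce
    then have "serves c t p R ?S'"
      unfolding serves_def by (rule feasible_weaken) simp
    moreover have "sched_length t ?S' = \<bar>origin r - p\<bar> + v - u"
      using ne by (simp add: sched_length_def last_map v_def)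
    ultimately show ?thesis using L_le[of c t p R ?S'] by simp
  qed
  ultimately show ?thesis using that[OF r(1) _ r'(1), of u v] by metis
qed

subsection \<open>Start times\<close>

text \<open>A \<open>LEAST\<close> over the reals needs an attained minimum. Moving an admissible
  time back to \<open>k\<close> of its pending set keeps this set and admissibility, so it suffices
  to minimize over finitely many values \<open>k R\<close>. As \<open>k R\<close> is a maximum of
  three terms, the start is the idle time, a release time, or a time with equality in the waiting
  condition.\<close>

lemma start_time_properties:
  fixes \<Theta> t p :: real
  assumes "1 \<le> c" "1 < \<Theta>" "finite \<sigma>" "D \<subseteq> \<sigma>" "D \<noteq> \<sigma>"
  defines "t' \<equiv> start_time c \<Theta> \<sigma> D t p"
  defines "R \<equiv> pending \<sigma> D t'"
  shows "t \<le> t'" "R \<noteq> {}" "L c t' p R \<le> (\<Theta> - 1) * t'"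
    and "t' = t \<or> t' \<in> release ` R \<or> L c t' p R = (\<Theta> - 1) * t'"
    and "\<And>s. t \<le> s \<Longrightarrow> pending \<sigma> D s \<noteq> {} \<Longrightarrow> L c s p (pending \<sigma> D s) \<le> (\<Theta> - 1) * s \<Longrightarrow> t' \<le> s"
proof -
  define Q where "Q s \<longleftrightarrow> t \<le> s \<and> pending \<sigma> D s \<noteq> {} \<and> L c s p (pending \<sigma> D s) / (\<Theta> - 1) \<le> s" for s
  have fin: "finite (pending \<sigma> D s)" for s using assms(3) by (simp add: pending_def)
  define len where "len R = L c (Max (release ` R)) p R" for R
  have len: "L c s p R = len R" if "finite R" "\<forall>r\<in>R. release r \<le> s" for s R
    unfolding len_def using that by (intro L_eq[OF assms(1)]) auto
  text \<open>The earliest time at which exactly \<open>R\<close> could be started.\<close>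
  define k where "k R = max t (max (Max (release ` R)) (len R / (\<Theta> - 1)))" for R
  have Qk: "k (pending \<sigma> D s) \<le> s \<and> Q (k (pending \<sigma> D s)) \<and> pending \<sigma> D (k (pending \<sigma> D s)) = pending \<sigma> D s"
    if Q: "Q s" for s
  proof -
    let ?R = "pending \<sigma> D s"
    have R: "finite ?R" "?R \<noteq> {}" "\<forall>r\<in>?R. release r \<le> s" using Q fin by (auto simp: Q_def pending_def)
    have le: "k ?R \<le> s" using Q R len[OF R(1,3)] by (auto simp: k_def Q_def)
    have rel: "release r \<le> k ?R" if "r \<in> ?R" for r
      using R(1) that Max_ge[of "release ` ?R" "release r"] by (auto simp: k_def le_max_iff_disj)
    have eq: "pending \<sigma> D (k ?R) = ?R"
      using le rel by (force simp: pending_def)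
    have "L c (k ?R) p ?R = len ?R" using rel by (intro len R) auto
    then have "Q (k ?R)" using eq R(2) by (auto simp: Q_def) (auto simp: k_def)
    then show ?thesis using le eq by blast
  qed
  let ?K = "{s \<in> k ` Pow \<sigma>. Q s}"
  have "finite ?K" using assms(3) by simp
  have "Q (k (\<sigma> - D))"
  proof -
    have sub: "finite (\<sigma> - D)" "\<sigma> - D \<noteq> {}" using assms(3-5) by auto
    have rel: "release r \<le> k (\<sigma> - D)" if "r \<in> \<sigma> - D" for r
      using sub(1) that Max_ge[of "release ` (\<sigma> - D)" "release r"]
      by (auto simp: k_def le_max_iff_disj)
    then have "pending \<sigma> D (k (\<sigma> - D)) = \<sigma> - D" by (auto simp: pending_def)
    moreover have "L c (k (\<sigma> - D)) p (\<sigma> - D) = len (\<sigma> - D)" using rel sub by (intro len) auto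
    moreover have "t \<le> k (\<sigma> - D)" "len (\<sigma> - D) / (\<Theta> - 1) \<le> k (\<sigma> - D)"
      by (auto simp: k_def)
    ultimately show ?thesis using sub(2) by (simp add: Q_def)
  qed
  then have "k (\<sigma> - D) \<in> ?K" by auto
  then have "?K \<noteq> {}" by (metis empty_iff)
  define s0 where "s0 = Min ?K"
  have "s0 \<in> ?K" unfolding s0_def by (rule Min_in[OF \<open>finite ?K\<close> \<open>?K \<noteq> {}\<close>])
  then have s0: "Q s0" by blast
  have least: "s0 \<le> s" if "Q s" for s
  proof -
    have "pending \<sigma> D s \<in> Pow \<sigma>" by (auto simp: pending_def)
    then have "k (pending \<sigma> D s) \<in> ?K" using Qk[OF that] by blast
    then have "s0 \<le> k (pending \<sigma> D s)" unfolding s0_def using \<open>finite ?K\<close> by (intro Min_le)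
    then show ?thesis using Qk[OF that] by simp
  qed
  have t': "t' = s0"
    unfolding t'_def start_time_def using s0 least
    by (intro Least_equality) (auto simp: Q_def)
  then have Qt: "Q t'" and eq: "t' = k R"
    using s0 Qk[OF s0] least[of "k R"] by (auto simp: R_def)
  show "t \<le> t'" "R \<noteq> {}" "L c t' p R \<le> (\<Theta> - 1) * t'"
    using Qt assms(2) by (auto simp: Q_def R_def field_simps)
  show "t' \<le> s" if "t \<le> s" "pending \<sigma> D s \<noteq> {}" "L c s p (pending \<sigma> D s) \<le> (\<Theta> - 1) * s" for s
    using least[of s] that assms(2) t' by (auto simp: Q_def field_simps)
  have "L c t' p R = len R" using fin by (intro len) (auto simp: R_def pending_def)
  moreover have "Max (release ` R) \<in> release ` R"
    using Qt fin by (intro Max_in) (auto simp: R_def Q_def)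
  ultimately show "t' = t \<or> t' \<in> release ` R \<or> L c t' p R = (\<Theta> - 1) * t'"
    using eq assms(2) unfolding k_def max_def by (auto split: if_splits)
qed

lemma start_time_eqI:
  assumes "1 \<le> c" "1 < \<Theta>" "finite \<sigma>" "D \<subseteq> \<sigma>" "D \<noteq> \<sigma>"
    and "t \<le> s" "pending \<sigma> D s \<noteq> {}" "L c s p (pending \<sigma> D s) \<le> (\<Theta> - 1) * s"
    and "\<And>s'. t \<le> s' \<Longrightarrow> s' < s \<Longrightarrow> pending \<sigma> D s' \<noteq> {} \<Longrightarrow>
      (\<Theta> - 1) * s' < L c s' p (pending \<sigma> D s')"
  shows "start_time c \<Theta> \<sigma> D t p = s"
proof (rule antisym)
  note sp = start_time_properties[OF assms(1-5), where t = t and p = p]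
  show "start_time c \<Theta> \<sigma> D t p \<le> s" using sp(5) assms(6-8) by blast
  show "s \<le> start_time c \<Theta> \<sigma> D t p"
    using assms(9) sp(1-3) by (meson not_less)
qed

subsection \<open>Runs of Smartstart\<close>

type_synonym state = "real \<times> real \<times> request set"

text \<open>One round as a relation on states, so that a run can be followed forwards from its
  beginning, as the lower bounds require; inverting \<open>smartstart_idle\<close> exposes the last
  round instead.\<close>

inductive ss_step :: "enat \<Rightarrow> real \<Rightarrow> request set \<Rightarrow> state \<Rightarrow> state \<Rightarrow> bool"
  for c \<Theta> \<sigma> where
  "D \<noteq> \<sigma> \<Longrightarrow> t' = start_time c \<Theta> \<sigma> D t p \<Longrightarrow> R = pending \<sigma> D t' \<Longrightarrow>
    shortest_schedule c t' p R S \<Longrightarrow>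
    ss_step c \<Theta> \<sigma> (t, p, D) (t' + sched_length t' S, end_position p S, D \<union> R)"

lemma smartstart_idle_reach:
  "smartstart_idle c \<Theta> \<sigma> t p D \<Longrightarrow> (ss_step c \<Theta> \<sigma>)\<^sup>*\<^sup>* (0, 0, {}) (t, p, D)"
proof (induction rule: smartstart_idle.induct)
  case (step t p D t' R S)
  then show ?case by (blast intro: ss_step.intros rtranclp.rtrancl_into_rtrancl)
qed simp

lemma smartstart_idle_subset: "smartstart_idle c \<Theta> \<sigma> t p D \<Longrightarrow> D \<subseteq> \<sigma>"
  by (induction rule: smartstart_idle.induct) (auto simp: pending_def)

lemma smartstart_complete:
  assumes "1 \<le> c" "1 < \<Theta>" "finite \<sigma>" "smartstart_idle c \<Theta> \<sigma> t p D"
  shows "\<exists>t' p'. smartstart_idle c \<Theta> \<sigma> t' p' \<sigma>"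
  using assms(4)
proof (induction "card (\<sigma> - D)" arbitrary: t p D rule: less_induct)
  case less
  show ?case
  proof (cases "D = \<sigma>")
    case False
    define t' where "t' = start_time c \<Theta> \<sigma> D t p"
    define R where "R = pending \<sigma> D t'"
    have sub: "D \<subseteq> \<sigma>" using smartstart_idle_subset less(2) .
    have R: "R \<noteq> {}" using start_time_properties(2)[OF assms(1-3) sub False] by (simp add: R_def t'_def)
    have "finite R" using assms(3) by (simp add: R_def pending_def)
    then obtain S where "shortest_schedule c t' p R S"
      using shortest_schedule_exists assms(1) by blast
    then have "smartstart_idle c \<Theta> \<sigma> (t' + sched_length t' S) (end_position p S) (D \<union> R)"
      using less(2) False by (intro smartstart_idle.step) (auto simp: t'_def R_def)
    moreover have "card (\<sigma> - (D \<union> R)) < card (\<sigma> - D)"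
      using R assms(3) by (intro psubset_card_mono) (auto simp: R_def pending_def)
    ultimately show ?thesis using less(1) by blast
  qed (use less in blast)
qed

text \<open>Ensures that statements about all \<open>A\<close> with
  \<open>smartstart c \<Theta> A\<close> are not vacuous.\<close>

lemma smartstart_exists:
  assumes "1 \<le> c" "1 < \<Theta>"
  shows "\<exists>A. smartstart c \<Theta> A"
proof -
  have "\<exists>t p. smartstart_idle c \<Theta> \<sigma> t p \<sigma>" if "dar_instance \<sigma>" for \<sigma>
    using smartstart_complete[OF assms _ smartstart_idle.start] that by (auto simp: dar_instance_def)
  then show ?thesis unfolding smartstart_def by metis
qed

section \<open>Bounds on the optimum and on the competitive ratio\<close>

lemma serves_le_Opt:
  assumes "1 \<le> c" "finite \<sigma>" "\<And>S. serves c 0 0 \<sigma> S \<Longrightarrow> x \<le> sched_length 0 S"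
  shows "x \<le> Opt c \<sigma>"
  unfolding Opt_def using assms by (rule le_L)

lemma competitive_ratio_le:
  assumes "\<And>\<sigma>. dar_instance \<sigma> \<Longrightarrow> A \<sigma> \<le> \<rho> * Opt c \<sigma>"
  shows "competitive_ratio c A \<le> ereal \<rho>"
  unfolding competitive_ratio_def using assms by (intro Inf_lower) auto

lemma le_competitive_ratio:
  assumes "\<And>\<rho>. (\<And>\<sigma>. dar_instance \<sigma> \<Longrightarrow> A \<sigma> \<le> \<rho> * Opt c \<sigma>) \<Longrightarrow> x \<le> \<rho>"
  shows "ereal x \<le> competitive_ratio c A"
  unfolding competitive_ratio_def using assms by (intro Inf_greatest) auto

subsection \<open>Upper bound\<close>

text \<open>Records the last two rounds: \<open>t\<close> and \<open>p\<close> are the start of the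
  last schedule, \<open>s\<close> is the start time of the one before, or 0. Requests that a
  schedule leaves unserved were released no earlier than it started. Unit speed and the waiting
  condition give \<open>\<bar>q\<bar> \<le> t + (\<Theta> - 1) * t\<close>.\<close>

lemma smartstart_idle_invariant:
  assumes "1 \<le> c" "1 < \<Theta>" "dar_instance \<sigma>" "smartstart_idle c \<Theta> \<sigma> e q D"
  shows "(D = {} \<and> e = 0 \<and> q = 0) \<or>
    (\<exists>t p R S s. shortest_schedule c t p R S \<and> R \<noteq> {} \<and> R \<subseteq> D \<and> (\<forall>r\<in>R. release r \<le> t)
      \<and> e = t + sched_length t S \<and> q = end_position p S
      \<and> 0 \<le> t \<and> sched_length t S \<le> (\<Theta> - 1) * t \<and> \<bar>q\<bar> \<le> \<Theta> * t \<and> \<bar>q\<bar> \<le> e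
      \<and> (\<forall>r\<in>\<sigma> - D. t \<le> release r)
      \<and> 0 \<le> s \<and> \<bar>p\<bar> \<le> \<Theta> * s \<and> (\<forall>r\<in>R. s \<le> release r))"
  using assms(4)
proof (induction rule: smartstart_idle.induct)
  case (step e q D t' R S)
  have fin: "finite \<sigma>" and rel0: "\<forall>r\<in>\<sigma>. 0 \<le> release r"
    using assms(3) by (auto simp: dar_instance_def)
  have "\<exists>s\<ge>0. \<bar>q\<bar> \<le> \<Theta> * s \<and> \<bar>q\<bar> \<le> e \<and> (\<forall>r\<in>\<sigma> - D. s \<le> release r)"
    using step.IH
  proof (elim disjE)
    assume "D = {} \<and> e = 0 \<and> q = 0"
    then show ?thesis using rel0 by (intro exI[of _ 0]) auto
  qed blast
  then obtain s where s: "0 \<le> s" "\<bar>q\<bar> \<le> \<Theta> * s" "\<bar>q\<bar> \<le> e" "\<forall>r\<in>\<sigma> - D. s \<le> release r" by blast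
  note sp = start_time_properties[OF assms(1,2) fin smartstart_idle_subset[OF step.hyps(1)] step.hyps(2),
      where t = e and p = q, folded step.hyps(3), folded step.hyps(4)]
  have len: "sched_length t' S \<le> (\<Theta> - 1) * t'"
    using sp(3) shortest_schedule_L[OF step.hyps(5)] by simp
  have serves: "serves c t' q R S" using step.hyps(5) by (simp add: shortest_schedule_def)
  obtain r where r: "(t' + sched_length t' S, Deliver r) \<in> set S" "end_position q S = destination r"
    using serves_last[OF serves sp(2)] by metis
  have pos: "\<bar>end_position q S - q\<bar> \<le> sched_length t' S"
    using serves_facts(1)[OF serves r(1)] r(2) by simp
  have rest: "\<forall>r\<in>\<sigma> - (D \<union> R). t' \<le> release r" "\<forall>r\<in>R. release r \<le> t'" "R \<subseteq> \<sigma> - D"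
    by (auto simp: step.hyps(4) pending_def)
  have "0 \<le> t'" "\<bar>end_position q S\<bar> \<le> t' + sched_length t' S" using s(3) sp(1) pos by auto
  moreover from this have "\<bar>end_position q S\<bar> \<le> \<Theta> * t'" using len by (auto simp: algebra_simps)
  moreover have "R \<subseteq> D \<union> R" "\<forall>r\<in>R. s \<le> release r" using rest(3) s(4) by auto
  ultimately show ?case
    using step.hyps(5) sp(2) len rest(1,2) s(1,2) by blast
qed simp

text \<open>In the following two estimates, \<open>C\<close> is the completion time of an optimal schedule, which
  makes its first pickup \<open>a\<close> among the final requests at time \<open>Ta\<close> and a delivery at the final
  starting point \<open>q\<close> of the server at time \<open>Tq\<close>. In the second one, it serves the previous
  batch of requests from time \<open>Tb\<close> at \<open>b\<close> until time \<open>Tz\<close> at \<open>z\<close>.\<close>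

lemma waiting_estimate:
  fixes \<Theta> :: real
  assumes "1 < \<Theta>" "l \<le> \<bar>a - q\<bar> + C - Ta" "\<bar>a\<bar> \<le> Ta" "t \<le> Ta" "\<bar>q\<bar> \<le> \<Theta> * t"
    "\<bar>q\<bar> \<le> Tq" "Tq \<le> C" "\<bar>a - q\<bar> \<le> \<bar>Ta - Tq\<bar>"
  shows "(\<Theta> + 2) * l \<le> (2 * \<Theta> + 2) * C"
proof (cases "Tq \<le> Ta")
  case True
  then have "l \<le> C" "0 \<le> C" using assms by auto
  then have "(\<Theta> + 2) * l \<le> (\<Theta> + 2) * C" "0 \<le> \<Theta> * C"
    using assms(1) by (auto intro!: mult_left_mono)
  then show ?thesis by (simp add: algebra_simps)
next
  case False
  \<comment> \<open>With weights \<Theta> and 2, the bounds \<open>2 * C - 2 * t\<close> and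
    \<open>\<Theta> * t + C\<close> on \<open>l\<close> add up to one without
    \<open>t\<close>.\<close>
  then have "l \<le> 2 * C - 2 * t" using assms by auto
  then have "\<Theta> * l \<le> \<Theta> * (2 * C - 2 * t)" using assms(1) by (intro mult_left_mono) auto
  moreover have "l \<le> \<Theta> * t + C" using assms by auto
  ultimately show ?thesis by (simp add: algebra_simps)
qed

lemma no_waiting_estimate:
  fixes \<Theta> \<delta> :: real
  assumes \<Theta>: "2 \<le> \<Theta>" "\<Theta> \<le> 2.06" and \<delta>: "3 * (\<Theta> * \<delta>) + 3 * \<delta> = \<Theta> - 1"
    and l: "l \<le> \<bar>a - q\<bar> + C - Ta" and l': "l' \<le> (\<Theta> - 1) * t"
    and a: "Ta \<le> C" "t \<le> Ta" "0 \<le> t"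
    and q: "\<bar>q\<bar> \<le> Tq" "Tq \<le> C" "\<bar>a - q\<bar> \<le> \<bar>Ta - Tq\<bar>"
    and b: "l' \<le> \<bar>b - p\<bar> + Tz - Tb" "\<bar>b\<bar> \<le> Tb" "s \<le> Tb" "Tb \<le> Tq" "\<bar>p\<bar> \<le> \<Theta> * s"
    and z: "\<bar>z - p\<bar> + \<bar>z - q\<bar> \<le> l'" "\<bar>a - z\<bar> \<le> \<bar>Ta - Tz\<bar>" "Tz \<le> C"
  shows "t + l' + l \<le> (\<Theta> + 1 - \<delta>) * C"
proof -
  have C: "0 \<le> C" "t \<le> C" using a by auto
  have \<delta>b: "0 \<le> \<delta>" "\<delta> \<le> 0.12"
  proof -
    have e: "\<delta> * (3 * \<Theta> + 3) = \<Theta> - 1" using \<delta> by (simp add: algebra_simps)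
    then show "0 \<le> \<delta>" using \<Theta> by (smt (verit) mult_neg_pos)
    show "\<delta> \<le> 0.12"
    proof (rule ccontr)
      assume "\<not> \<delta> \<le> 0.12"
      then have "0.12 * 9 \<le> \<delta> * (3 * \<Theta> + 3)" using \<Theta> by (intro mult_mono) auto
      then show False using e \<Theta> by simp
    qed
  qed
  have tC: "\<Theta> * t \<le> \<Theta> * C" using C \<Theta> by (intro mult_left_mono) auto
  have dC: "0 \<le> \<delta> * C" "\<delta> * C \<le> 0.12 * C"
    using \<delta>b C mult_right_mono[of \<delta> "0.12" C] by auto
  show ?thesis
  proof (cases "Ta \<le> Tq")
    case True
    then have "t + l' + l \<le> \<Theta> * t + 2 * C - 2 * t" using l l' a q by (auto simp: algebra_simps)
    moreover have "\<Theta> * t - 2 * t \<le> \<Theta> * C - 2 * C"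
      using mult_left_mono[OF C(2), of "\<Theta> - 2"] \<Theta> by (simp add: algebra_simps)
    ultimately show ?thesis using dC C by (simp add: algebra_simps)
  next
    case qa: False
    \<comment> \<open>Now \<open>l \<le> C - Tq\<close>, so a visit of \<open>q\<close> at time
      \<open>\<delta> * C\<close> or later suffices.\<close>
    show ?thesis
    proof (cases "\<delta> * C \<le> Tq")
      case True
      have "t + l' + l \<le> \<Theta> * t + C - Tq" using qa l l' q by (auto simp: algebra_simps)
      then show ?thesis using True tC by (simp add: algebra_simps)
    next
      case False
      \<comment> \<open>An early visit of \<open>q\<close> bounds \<open>s\<close> too, so both
        \<open>p\<close> and \<open>q\<close> are near the origin.\<close>
      have "\<Theta> * s \<le> \<Theta> * (\<delta> * C)" using False b \<Theta> by (intro mult_left_mono) auto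
      then have pq: "\<bar>p\<bar> \<le> \<Theta> * (\<delta> * C)" "\<bar>q\<bar> \<le> \<delta> * C" using b q False by auto
      have e: "3 * (\<Theta> * (\<delta> * C)) + 3 * (\<delta> * C) = \<Theta> * C - C"
        using arg_cong[OF \<delta>, of "\<lambda>x. x * C"] by (simp add: algebra_simps)
      define w h P Q where "w = \<bar>a - z\<bar>" and "h = \<bar>z - q\<bar>" and "P = \<bar>p\<bar>" and "Q = \<bar>q\<bar>"
      have total: "t + l' + l \<le> l' + w + h + C" using l a by (auto simp: w_def h_def)
      \<comment> \<open>The previous schedule covers \<open>\<bar>z - p\<bar> + h\<close>, where
        \<open>\<bar>z - p\<bar>\<close> is at least \<open>h - P - Q\<close>; hence
        \<open>h\<close> is at most about half of \<open>l'\<close>.\<close>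
      have "h \<le> \<bar>z - p\<bar> + P + Q" by (auto simp: h_def P_def Q_def)
      then have zq: "2 * h \<le> l' + P + Q" using z(1) by (simp add: h_def)
      have l'C: "l' \<le> \<Theta> * t - t" "\<Theta> * t - t \<le> \<Theta> * C - C"
        using l' mult_left_mono[OF C(2), of "\<Theta> - 1"] \<Theta> by (auto simp: algebra_simps)
      define x y g where "x = \<Theta> * (\<delta> * C)" and "y = \<delta> * C" and "g = \<Theta> * C"
      have pq: "P \<le> x" "Q \<le> y" and e: "3 * x + 3 * y = g - C"
        using pq e by (simp_all add: P_def Q_def x_def y_def g_def)
      have expand: "(\<Theta> + 1 - \<delta>) * C = g + C - y" by (simp add: g_def y_def algebra_simps)
      show ?thesis
      proof (cases "Tz \<le> Ta")
        case True
        then have "l' + w \<le> P + C" using z b a by (auto simp: w_def P_def)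
        then have "t + l' + l \<le> 2 * C + P + (g - C + P + Q) / 2"
          using total zq l'C by (simp add: g_def field_simps)
        \<comment> \<open>This case determines \<delta>: after inserting \<open>P \<le> x\<close>
          and \<open>Q \<le> y\<close>, what remains is \<open>3 * x + 3 * y \<le> g - C\<close>,
          which holds with equality.\<close>
        then show ?thesis unfolding expand using pq e by argo
      next
        case False
        \<comment> \<open>This order leaves slack, so rough numerical bounds on \<open>g\<close> and
          \<open>y\<close> do.\<close>
        then have "w \<le> C - t" using z a by (auto simp: w_def)
        then have "t + l' + l \<le> 2 * C + (l' - t) + (g - C + P + Q) / 2"
          using total zq l'C by (simp add: g_def field_simps)
        moreover have "l' - t \<le> g - 2 * C"
          using l'C mult_left_mono[OF C(2), of "\<Theta> - 2"] \<Theta> by (simp add: g_def algebra_simps)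
        moreover have "g \<le> 103 / 50 * C" unfolding g_def using \<Theta> C by (intro mult_right_mono) auto
        moreover have "0 \<le> y" "y \<le> 3 / 25 * C" using dC by (simp_all add: y_def)
        moreover have "0 \<le> x" using \<Theta> dC by (simp add: x_def)
        ultimately show ?thesis unfolding expand using pq e C by argo
      qed
    qed
  qed
qed

text \<open>An arbitrary offline schedule \<open>S'\<close> is compared with the last round,
  according to the reason for its start time \<open>t'\<close>. At a release time,
  \<open>t' \<le> C\<close> and the waiting condition give \<open>T \<le> \<Theta> * C\<close>.
  After waiting, \<open>T\<close> is \<open>\<Theta> * t'\<close> with
  \<open>t' = l / (\<Theta> - 1)\<close>. Otherwise the last two schedules follow each other without
  a pause.\<close>

lemma smartstart_upper_bound:
  assumes "1 \<le> c" "2 \<le> \<Theta>" "\<Theta> \<le> 2.06" and \<delta>: "3 * (\<Theta> * \<delta>) + 3 * \<delta> = \<Theta> - 1"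
    and f1: "2 * \<Theta> * (\<Theta> + 1) \<le> \<rho> * ((\<Theta> + 2) * (\<Theta> - 1))"
    and f2: "\<Theta> + 1 - \<delta> \<le> \<rho>" and "\<Theta> \<le> \<rho>"
    and "dar_instance \<sigma>" "smartstart_idle c \<Theta> \<sigma> T p \<sigma>"
  shows "T \<le> \<rho> * Opt c \<sigma>"
proof -
  have fin: "finite \<sigma>" and "\<sigma> \<noteq> {}" and rel0: "\<forall>r\<in>\<sigma>. 0 \<le> release r"
    using assms(8) by (auto simp: dar_instance_def)
  have \<rho>: "0 < \<rho>" "1 < \<Theta>" using assms by auto
  have main: "T \<le> \<rho> * sched_length 0 S'" if S': "serves c 0 0 \<sigma> S'" for S'
    using assms(9)
  proof (cases rule: smartstart_idle.cases)
    case start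
    then show ?thesis using \<open>\<sigma> \<noteq> {}\<close> by simp
  next
    case (step t q D t' R S)
    define C where "C = sched_length 0 S'"
    have D: "D \<subseteq> \<sigma>" "D \<noteq> \<sigma>" using smartstart_idle_subset step(4) step(5) by auto
    note sp = start_time_properties[OF assms(1) \<rho>(2) fin D, where t = t and p = q,
        folded step(6), folded step(7)]
    have R: "R = \<sigma> - D" using step(3) by (auto simp: step(7) pending_def)
    define l where "l = L c t' q R"
    have T: "T = t' + l" using step(1) shortest_schedule_L[OF step(8)] by (simp add: l_def)
    have R': "R \<subseteq> \<sigma>" "\<forall>r\<in>R. release r \<le> t'" using R by (auto simp: step(7) pending_def)
    note F = serves_facts[OF S', simplified, folded C_def]
    obtain r u v where r: "r \<in> R" "(u, Pickup r) \<in> set S'" and "v \<le> C"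
      and l: "l \<le> \<bar>origin r - q\<bar> + v - u"
      using L_le_restriction[OF assms(1) fin R'(1) sp(2) S'] R'(2) F(2) unfolding l_def
      by (metis fst_conv)
    define a where "a = origin r"
    have l: "l \<le> \<bar>a - q\<bar> + C - u" using l \<open>v \<le> C\<close> by (simp add: a_def)
    have a: "\<bar>a\<bar> \<le> u" "u \<le> C" "release r \<le> u"
      using F(1,2)[OF r(2)] feasible_release S' r(2) by (auto simp: a_def serves_def)
    have C0: "0 \<le> C" using a by auto
    consider (start) "t' = t" | (release) "t' \<in> release ` R" | (wait) "l = (\<Theta> - 1) * t'"
      using sp(4) unfolding l_def by blast
    then have "T \<le> \<rho> * C"
    proof cases
      case release
      then obtain r' where r': "r' \<in> \<sigma>" "t' = release r'" using R'(1) by auto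
      obtain u' where "(u', Pickup r') \<in> set S'" "release r' \<le> u'" using serves_pickup[OF S' r'(1)] .
      then have "t' \<le> C" using F(2)[of "(u', Pickup r')"] r'(2) by auto
      then have "\<Theta> * t' \<le> \<Theta> * C" using \<rho> by (intro mult_left_mono) auto
      then have "T \<le> \<Theta> * C" using sp(3) unfolding T l_def by (simp add: algebra_simps)
      then show ?thesis using mult_right_mono[OF assms(7) C0] by linarith
    next
      case wait
      have "(\<Theta> + 2) * l \<le> (2 * \<Theta> + 2) * C"
        using smartstart_idle_invariant[OF assms(1) \<rho>(2) assms(8) step(4)]
      proof (elim disjE exE conjE)
        assume "q = 0"
        then show ?thesis
          \<comment> \<open>No earlier round: \<open>q\<close> is the origin, where the offline
            server is at time 0, so 0 serves for both \<open>t\<close> and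
            \<open>Tq\<close>.\<close>
          using l a by (intro waiting_estimate[OF \<rho>(2), of l a q C u 0 0]) auto
      next
        fix t0 p0 R0 S0 s0
        assume S0: "shortest_schedule c t0 p0 R0 S0" "R0 \<noteq> {}" "R0 \<subseteq> D" "q = end_position p0 S0"
          "\<bar>q\<bar> \<le> \<Theta> * t0" "\<forall>r\<in>\<sigma> - D. t0 \<le> release r"
        obtain rq where rq: "rq \<in> R0" "q = destination rq"
          using serves_last S0 unfolding shortest_schedule_def by metis
        then obtain w where w: "(w, Deliver rq) \<in> set S'"
          using serves_pickup[OF S', of rq] S0(3) D by blast
        have "t0 \<le> u" using S0(6) r(1) a(3) unfolding R by (meson order_trans)
        then show ?thesis
          using l a w F(1,2)[OF w] F(3)[OF r(2) w] rq(2) S0(5)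
          by (intro waiting_estimate[OF \<rho>(2), of l a q C u t0 w]) (auto simp: a_def)
      qed
      then have "\<Theta> * ((\<Theta> + 2) * l) \<le> \<Theta> * ((2 * \<Theta> + 2) * C)" using \<rho> by (intro mult_left_mono) auto
      also have "\<dots> = (2 * \<Theta> * (\<Theta> + 1)) * C" by (simp add: algebra_simps)
      also have "\<dots> \<le> (\<rho> * ((\<Theta> + 2) * (\<Theta> - 1))) * C" using f1 C0 by (rule mult_right_mono)
      also have "\<Theta> * ((\<Theta> + 2) * l) = ((\<Theta> + 2) * (\<Theta> - 1)) * T"
        unfolding T wait by (simp add: algebra_simps)
      finally have "((\<Theta> + 2) * (\<Theta> - 1)) * T \<le> ((\<Theta> + 2) * (\<Theta> - 1)) * (\<rho> * C)"
        by (simp add: algebra_simps)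
      then show ?thesis using \<rho> by (subst (asm) mult_le_cancel_left_pos) auto
    next
      case start
      show ?thesis
        using smartstart_idle_invariant[OF assms(1) \<rho>(2) assms(8) step(4)]
      proof (elim disjE exE conjE)
        assume "t = 0"
        then have "l \<le> 0" using start sp(3) by (simp add: l_def)
        then show ?thesis using T \<open>t = 0\<close> start C0 \<rho> by (simp add: order_trans[of _ 0])
      next
        fix t0 p0 R0 S0 s0
        assume S0: "shortest_schedule c t0 p0 R0 S0" "R0 \<noteq> {}" "R0 \<subseteq> D" "\<forall>r\<in>R0. release r \<le> t0"
          "t = t0 + sched_length t0 S0" "q = end_position p0 S0"
          "0 \<le> t0" "sched_length t0 S0 \<le> (\<Theta> - 1) * t0" "\<forall>r\<in>\<sigma> - D. t0 \<le> release r"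
          "0 \<le> s0" "\<bar>p0\<bar> \<le> \<Theta> * s0" "\<forall>r\<in>R0. s0 \<le> release r"
        have serves: "serves c t0 p0 R0 S0" using S0(1) by (simp add: shortest_schedule_def)
        obtain rq where rq: "rq \<in> R0" "q = destination rq"
            "(t0 + sched_length t0 S0, Deliver rq) \<in> set S0"
          using serves_last[OF serves S0(2)] S0(6) by metis
        then obtain w where w: "(w, Deliver rq) \<in> set S'"
          using serves_pickup[OF S', of rq] S0(3) D by blast
        obtain rb rz ub vz where bz: "rb \<in> R0" "(ub, Pickup rb) \<in> set S'"
            "rz \<in> R0" "(vz, Deliver rz) \<in> set S'"
            "\<And>x. x \<in> set S' \<Longrightarrow> request_of (snd x) \<in> R0 \<Longrightarrow> ub \<le> fst x \<and> fst x \<le> vz"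
            "\<And>t p. \<forall>r\<in>R0. release r \<le> t \<Longrightarrow> L c t p R0 \<le> \<bar>origin rb - p\<bar> + vz - ub"
          by (rule L_le_restriction[OF assms(1) fin subset_trans[OF S0(3) D(1)] S0(2) S']) (rule that)
        define l' where "l' = sched_length t0 S0"
        \<comment> \<open>The offline order of serving \<open>R0\<close> was open to Smartstart as
          well, after a move from \<open>p0\<close> to the first pickup.\<close>
        have l': "l' \<le> \<bar>origin rb - p0\<bar> + vz - ub"
          using bz(6)[OF S0(4)] shortest_schedule_L[OF S0(1)] by (simp add: l'_def)
        \<comment> \<open>\<open>S0\<close> has to deliver \<open>rz\<close> too, hence it visits
          this destination no later than its end at \<open>q\<close>.\<close>
        obtain w' where w': "(w', Deliver rz) \<in> set S0" using serves_pickup[OF serves bz(3)] by metis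
        have "t0 + l' + l \<le> (\<Theta> + 1 - \<delta>) * C"
        proof (rule no_waiting_estimate[OF assms(2,3) \<delta> l _ a(2)])
          show "l' \<le> (\<Theta> - 1) * t0" using S0(8) by (simp add: l'_def)
          show "t0 \<le> u" using S0(9) r(1) a(3) unfolding R by (meson order_trans)
          show "\<bar>q\<bar> \<le> w" "w \<le> C" using F(1,2)[OF w] rq(2) by auto
          show "\<bar>a - q\<bar> \<le> \<bar>u - w\<bar>" using F(3)[OF r(2) w] rq(2) by (simp add: a_def)
          show "\<bar>origin rb\<bar> \<le> ub" using F(1)[OF bz(2)] by simp
          have "release rb \<le> ub" using feasible_release S' bz(2) unfolding serves_def by blast
          then show "s0 \<le> ub" using bz(1) S0(12) by (meson order_trans)
          show "ub \<le> w" using bz(5)[OF w] rq(1) by simp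
          show "\<bar>a - destination rz\<bar> \<le> \<bar>u - vz\<bar>" using F(3)[OF r(2) bz(4)] by (simp add: a_def)
          show "vz \<le> C" using F(2)[OF bz(4)] by simp
          show "\<bar>destination rz - p0\<bar> + \<bar>destination rz - q\<bar> \<le> l'"
            using serves_facts(1)[OF serves w'] serves_facts(2,3)[OF serves w'] rq(2,3)
            by (fastforce simp: l'_def)
        qed (fact S0(7), fact l', fact S0(11))
        also have "\<dots> \<le> \<rho> * C" using f2 C0 by (rule mult_right_mono)
        finally show ?thesis using T start S0(5) by (simp add: l'_def)
      qed
    qed
    then show ?thesis by (simp add: C_def)
  qed
  have "T / \<rho> \<le> Opt c \<sigma>"
    using main \<rho> by (intro serves_le_Opt[OF assms(1) fin]) (simp add: field_simps)
  then show ?thesis using \<rho> by (simp add: field_simps)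
qed

subsection \<open>Lower bounds\<close>

lemma reach_next:
  assumes "(ss_step c \<Theta> \<sigma>)\<^sup>*\<^sup>* (t, p, D) (t', p', \<sigma>)" "D \<noteq> \<sigma>"
  obtains S s R where "s = start_time c \<Theta> \<sigma> D t p" "R = pending \<sigma> D s"
    "shortest_schedule c s p R S"
    "(ss_step c \<Theta> \<sigma>)\<^sup>*\<^sup>* (s + sched_length s S, end_position p S, D \<union> R) (t', p', \<sigma>)"
  using assms(1)
proof (cases rule: converse_rtranclpE)
  case base
  then show ?thesis using assms(2) by simp
next
  case (step y)
  show ?thesis using step(1) that step(2) by (cases rule: ss_step.cases) auto
qed

lemma reach_done:
  assumes "(ss_step c \<Theta> \<sigma>)\<^sup>*\<^sup>* (t, p, \<sigma>) (t', p', \<sigma>)"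
  shows "t' = t"
  using assms by (cases rule: converse_rtranclpE) (auto elim: ss_step.cases)

lemma serves_single:
  assumes "serves c t p {r} S" "destination r = origin r"
  shows "\<bar>origin r - p\<bar> \<le> sched_length t S" "end_position p S = origin r"
proof -
  obtain r' where "r' \<in> {r}" "(t + sched_length t S, Deliver r') \<in> set S"
    "end_position p S = destination r'"
    by (rule serves_last[OF assms(1)]) auto
  then show "\<bar>origin r - p\<bar> \<le> sched_length t S" "end_position p S = origin r"
    using serves_facts(1)[OF assms(1), of "(t + sched_length t S, Deliver r)"] assms(2) by auto
qed

lemma L_single:
  assumes "1 \<le> c" "destination r = origin r" "release r \<le> t"
  shows "L c t p {r} = \<bar>origin r - p\<bar>"
proof (rule antisym)
  show "L c t p {r} \<le> \<bar>origin r - p\<bar>"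
    using L_le_finish[OF assms(1), of "[r]" t p] assms by simp
  show "\<bar>origin r - p\<bar> \<le> L c t p {r}"
    using serves_single(1) assms by (intro le_L) auto
qed

text \<open>When \<open>r\<close> is released it is the only pending request and satisfies the
  waiting condition already, so the server leaves at once.\<close>

lemma reach_single:
  assumes reach: "(ss_step c \<Theta> \<sigma>)\<^sup>*\<^sup>* (t, p, D) (t', p', \<sigma>)"
    and "1 \<le> c" "1 < \<Theta>" "finite \<sigma>" "D \<subseteq> \<sigma>"
    and r: "r \<in> \<sigma>" "r \<notin> D" "destination r = origin r" "t \<le> release r"
      "\<bar>origin r - p\<bar> \<le> (\<Theta> - 1) * release r"
    and others: "\<And>r'. r' \<in> \<sigma> \<Longrightarrow> r' \<notin> D \<Longrightarrow> r' \<noteq> r \<Longrightarrow> release r < release r'"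
  shows "(ss_step c \<Theta> \<sigma>)\<^sup>*\<^sup>* (release r + \<bar>origin r - p\<bar>, origin r, insert r D) (t', p', \<sigma>)"
proof -
  have ne: "D \<noteq> \<sigma>" using r by blast
  have pend: "pending \<sigma> D (release r) = {r}"
    using r others by (force simp: pending_def)
  have early: "pending \<sigma> D s = {}" if "s < release r" for s
    using that others by (fastforce simp: pending_def)
  have st: "start_time c \<Theta> \<sigma> D t p = release r"
    using early r pend L_single[OF assms(2) r(3)] by (intro start_time_eqI assms ne) auto
  show ?thesis
    using reach ne
  proof (rule reach_next, goal_cases)
    case (1 S s R)
    then have S: "shortest_schedule c (release r) p {r} S" by (simp add: st pend)
    then have "end_position p S = origin r"
      using serves_single(2) r(3) by (auto simp: shortest_schedule_def)
    moreover have "sched_length (release r) S = \<bar>origin r - p\<bar>"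
      using shortest_schedule_L[OF S] L_single[OF assms(2) r(3)] by simp
    ultimately show ?case using 1 by (simp add: st pend)
  qed
qed

text \<open>The server is led along \<open>\<Theta>^j - 1\<close> for \<open>j \<le> m\<close>, being there at time \<open>\<Theta>^j\<close>: it always starts
  as soon as the next request appears.\<close>

definition bait :: "real \<Rightarrow> nat \<Rightarrow> request" where
  "bait \<Theta> j = Request (\<Theta> ^ Suc j - 1) (\<Theta> ^ Suc j - 1) (\<Theta> ^ j)"

lemma bait_sel [simp]:
  "origin (bait \<Theta> j) = \<Theta> ^ Suc j - 1" "destination (bait \<Theta> j) = \<Theta> ^ Suc j - 1"
  "release (bait \<Theta> j) = \<Theta> ^ j"
  by (simp_all add: bait_def)

lemma inj_bait: "1 < \<Theta> \<Longrightarrow> bait \<Theta> i = bait \<Theta> j \<longleftrightarrow> i = j"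
  by (auto simp: bait_def)

lemma reach_baits:
  assumes reach: "(ss_step c \<Theta> \<sigma>)\<^sup>*\<^sup>* (0, 0, {}) (t', p', \<sigma>)"
    and "1 \<le> c" "1 < \<Theta>" "finite \<sigma>" "\<sigma> = bait \<Theta> ` {..<m} \<union> Q"
    and Q: "\<And>r. r \<in> Q \<Longrightarrow> \<Theta> ^ m \<le> release r"
  shows "\<exists>t\<le>\<Theta> ^ m. (ss_step c \<Theta> \<sigma>)\<^sup>*\<^sup>* (t, \<Theta> ^ m - 1, bait \<Theta> ` {..<m}) (t', p', \<sigma>)"
proof -
  have "\<exists>t\<le>\<Theta> ^ j. (ss_step c \<Theta> \<sigma>)\<^sup>*\<^sup>* (t, \<Theta> ^ j - 1, bait \<Theta> ` {..<j}) (t', p', \<sigma>)"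
    if "j \<le> m" for j
    using that
  proof (induction j)
    case 0
    \<comment> \<open>Only \<open>t \<le> \<Theta> ^ j\<close> can be kept: the server is idle from
      time 0, but the first bait appears at time 1.\<close>
    then show ?case using reach by (intro exI[of _ 0]) auto
  next
    case (Suc j)
    then obtain t where t: "t \<le> \<Theta> ^ j"
      "(ss_step c \<Theta> \<sigma>)\<^sup>*\<^sup>* (t, \<Theta> ^ j - 1, bait \<Theta> ` {..<j}) (t', p', \<sigma>)" by auto
    \<comment> \<open>The distance to the next bait is exactly the longest length that may start at
      time \<open>\<Theta> ^ j\<close>, so the server arrives at time
      \<open>\<Theta> ^ Suc j\<close>.\<close>
    have dist: "\<bar>\<Theta> ^ Suc j - 1 - (\<Theta> ^ j - 1)\<bar> = (\<Theta> - 1) * \<Theta> ^ j"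
      using assms(3) by (simp add: algebra_simps)
    have "(ss_step c \<Theta> \<sigma>)\<^sup>*\<^sup>* (release (bait \<Theta> j) + \<bar>origin (bait \<Theta> j) - (\<Theta> ^ j - 1)\<bar>,
        origin (bait \<Theta> j), insert (bait \<Theta> j) (bait \<Theta> ` {..<j})) (t', p', \<sigma>)"
    proof (rule reach_single[OF t(2) assms(2-4)])
      fix r assume r: "r \<in> \<sigma>" "r \<notin> bait \<Theta> ` {..<j}" "r \<noteq> bait \<Theta> j"
      show "release (bait \<Theta> j) < release r"
      proof (cases "r \<in> Q")
        case True
        have "\<Theta> ^ j < \<Theta> ^ m" using Suc.prems assms(3) by (intro power_strict_increasing) auto
        then show ?thesis using Q[OF True] by simp
      next
        case False
        then obtain i where i: "r = bait \<Theta> i" using r(1) assms(5) by auto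
        then have "j < i" using r(2,3) by (cases i j rule: linorder_cases) auto
        then show ?thesis using i assms(3) by (simp add: power_strict_increasing)
      qed
    qed (use Suc.prems assms t(1) dist in \<open>auto simp: inj_bait\<close>)
    moreover have "insert (bait \<Theta> j) (bait \<Theta> ` {..<j}) = bait \<Theta> ` {..<Suc j}"
      by (auto simp: lessThan_Suc)
    ultimately show ?case using dist by (intro exI[of _ "\<Theta> ^ Suc j"]) (simp add: algebra_simps)
  qed
  then show ?thesis by blast
qed

text \<open>Lists that one sweep from \<open>p\<close> to \<open>q\<close> serves in this order
  without turning back, even with capacity 1.\<close>

fun rightward :: "real \<Rightarrow> request list \<Rightarrow> real \<Rightarrow> bool" where
  "rightward p [] q \<longleftrightarrow> q = p"
| "rightward p (r # rs) q \<longleftrightarrow> p \<le> origin r \<and> origin r \<le> destination r \<and> rightward (destination r) rs q"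

lemma rightward_append:
  "rightward p rs x \<Longrightarrow> rightward x rs' q \<Longrightarrow> rightward p (rs @ rs') q"
  by (induction p rs x rule: rightward.induct) auto

lemma finish_append:
  "finish t p (rs @ rs') = finish (finish t p rs) (if rs = [] then p else destination (last rs)) rs'"
  by (induction t p rs rule: finish.induct) auto

lemma finish_rightward:
  "rightward p rs q \<Longrightarrow> \<forall>r\<in>set rs. release r \<le> t \<Longrightarrow> finish t p rs = t + (q - p)"
proof (induction p rs q arbitrary: t rule: rightward.induct)
  case (2 p r rs q)
  define u where "u = max (t + \<bar>origin r - p\<bar>) (release r) + \<bar>destination r - origin r\<bar>"
  have u: "u = t + (destination r - p)" using 2 by (auto simp: u_def)
  then have "\<forall>r\<in>set rs. release r \<le> u" using 2 by fastforce
  then have "finish u (destination r) rs = u + (q - destination r)" using 2 by simp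
  then show ?case using u by (simp add: u_def)
qed auto

lemma rightward_baits:
  assumes "1 < \<Theta>"
  shows "rightward 0 (map (bait \<Theta>) [0..<m]) (\<Theta> ^ m - 1)"
proof (induction m)
  case (Suc m)
  have "\<Theta> ^ m \<le> \<Theta> ^ Suc m" using assms by simp
  then have "rightward (\<Theta> ^ m - 1) [bait \<Theta> m] (\<Theta> ^ Suc m - 1)" by simp
  with Suc show ?case by (simp add: rightward_append)
qed simp

text \<open>Otherwise \<open>(x - \<rho> * y) * \<Theta> ^ m\<close> outgrows the constants. Only
  the leading coefficients of the instances matter therefore.\<close>

lemma limit_ratio:
  fixes x y k k' \<Theta> :: real
  assumes "1 < \<Theta>" "\<And>m. n \<le> m \<Longrightarrow> x * \<Theta> ^ m - k \<le> \<rho> * (y * \<Theta> ^ m + k')"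
  shows "x \<le> \<rho> * y"
proof (rule ccontr)
  assume "\<not> x \<le> \<rho> * y"
  then have pos: "0 < x - \<rho> * y" by simp
  obtain m where m: "(k + \<rho> * k') / (x - \<rho> * y) < \<Theta> ^ m"
    using real_arch_pow[OF assms(1)] by blast
  have "\<Theta> ^ m \<le> \<Theta> ^ max m n" using assms(1) by (intro power_increasing) auto
  then have "(k + \<rho> * k') / (x - \<rho> * y) < \<Theta> ^ max m n" using m by linarith
  then have "k + \<rho> * k' < (x - \<rho> * y) * \<Theta> ^ max m n" using pos by (simp add: field_simps)
  then show False using assms(2)[of "max m n"] by (simp add: algebra_simps)
qed

lemma eventually_power_ge:
  fixes \<Theta> K :: real
  assumes "1 < \<Theta>"
  obtains n where "\<And>m. n \<le> m \<Longrightarrow> K \<le> \<Theta> ^ m"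
proof -
  obtain n where n: "K < \<Theta> ^ n" using real_arch_pow[OF assms] by blast
  show ?thesis
  proof (rule that[of n])
    fix m assume "n \<le> m"
    then have "\<Theta> ^ n \<le> \<Theta> ^ m" using assms by (intro power_increasing) auto
    then show "K \<le> \<Theta> ^ m" using n by simp
  qed
qed

text \<open>From \<open>\<Theta> ^ m - 1\<close> at time \<open>\<Theta> ^ m\<close>, every
  \<open>P\<close> up to the next bait position can be approached without waiting, so the position
  stays one less than the time. The requests in \<open>Q\<close> appear after this trip has
  started.\<close>

lemma reach_turning_point:
  assumes reach: "(ss_step c \<Theta> \<sigma>)\<^sup>*\<^sup>* (0, 0, {}) (t', p', \<sigma>)"
    and "1 \<le> c" "1 < \<Theta>" "finite Q"
    and \<sigma>: "\<sigma> = bait \<Theta> ` {..<m} \<union> insert (Request P P (\<Theta> ^ m)) Q"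
    and Q: "\<And>r. r \<in> Q \<Longrightarrow> \<Theta> ^ m < release r"
    and P: "\<Theta> ^ m - 1 \<le> P" "P \<le> \<Theta> ^ Suc m - 1"
  shows "(ss_step c \<Theta> \<sigma>)\<^sup>*\<^sup>* (P + 1, P, insert (Request P P (\<Theta> ^ m)) (bait \<Theta> ` {..<m})) (t', p', \<sigma>)"
proof -
  let ?r = "Request P P (\<Theta> ^ m)"
  have fin: "finite \<sigma>" using \<sigma> assms(4) by simp
  obtain t where t: "t \<le> \<Theta> ^ m"
    "(ss_step c \<Theta> \<sigma>)\<^sup>*\<^sup>* (t, \<Theta> ^ m - 1, bait \<Theta> ` {..<m}) (t', p', \<sigma>)"
    using reach_baits[OF reach assms(2,3) fin \<sigma>] Q by (force simp: less_imp_le)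
  have "?r \<notin> bait \<Theta> ` {..<m}"
    using assms(3) by (auto simp: bait_def)
  moreover have "\<Theta> ^ m < release r" if "r \<in> \<sigma>" "r \<notin> bait \<Theta> ` {..<m}" "r \<noteq> ?r" for r
    using that Q \<sigma> by auto
  ultimately have "(ss_step c \<Theta> \<sigma>)\<^sup>*\<^sup>* (release ?r + \<bar>origin ?r - (\<Theta> ^ m - 1)\<bar>, origin ?r,
      insert ?r (bait \<Theta> ` {..<m})) (t', p', \<sigma>)"
    using P \<sigma> t(1) by (intro reach_single[OF t(2) assms(2,3) fin]) (auto simp: algebra_simps)
  then show ?thesis using P(1) by simp
qed

text \<open>Replacing \<open>Opt\<close> by a larger \<open>y\<close> needs
  \<open>0 < \<rho>\<close>, which \<open>0 < x\<close> provides.\<close>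

lemma alg_le_mult:
  assumes "1 \<le> c" "finite \<sigma>" "x \<le> \<rho> * Opt c \<sigma>" "0 < x" "Opt c \<sigma> \<le> y"
  shows "x \<le> \<rho> * y"
proof -
  have "0 \<le> Opt c \<sigma>" using assms(1,2) sched_length_nonneg by (intro serves_le_Opt)
  then have "0 < \<rho>" using assms(3,4) by (smt (verit) mult_nonpos_nonneg)
  then have "\<rho> * Opt c \<sigma> \<le> \<rho> * y" using assms(5) by simp
  then show ?thesis using assms(3) by simp
qed

subsubsection \<open>The server waits before its last schedule\<close>

text \<open>If the ride from \<open>-T\<close> begins before the other one ends, the server still
  has to come back from \<open>-T\<close> to \<open>P\<close>. Otherwise it goes to
  \<open>T\<close>, \<open>P\<close>, \<open>-T\<close> and 0, in all \<open>3 * P\<close>.\<close>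

lemma two_rides_lower_bound:
  assumes "serves c s P {Request (-T) 0 u, Request T P u} S" "0 \<le> T" "T \<le> P"
  shows "min (2 * (P + T)) (3 * P) \<le> sched_length s S"
proof -
  obtain u1 v1 where 1: "(u1, Pickup (Request (-T) 0 u)) \<in> set S" "(v1, Deliver (Request (-T) 0 u)) \<in> set S"
      "u1 \<le> v1"
    by (rule serves_pickup[OF assms(1), of "Request (-T) 0 u"]) (auto intro: that)
  obtain u2 v2 where 2: "(u2, Pickup (Request T P u)) \<in> set S" "(v2, Deliver (Request T P u)) \<in> set S"
      "u2 \<le> v2"
    by (rule serves_pickup[OF assms(1), of "Request T P u"]) (auto intro: that)
  note F = serves_facts[OF assms(1)]
  have f: "v2 \<le> s + sched_length s S" "v1 \<le> s + sched_length s S" "s + (P + T) \<le> u1" "s + (P - T) \<le> u2"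
    "P + T \<le> \<bar>u1 - v2\<bar>" "P - T \<le> v2 - u2" "T \<le> v1 - u1"
    using F(2)[OF 2(2)] F(2)[OF 1(2)] F(1)[OF 1(1)] F(1)[OF 2(1)] F(3)[OF 1(1) 2(2)]
      F(3)[OF 2(2) 2(1)] F(3)[OF 1(2) 1(1)] assms(2,3) 1(3) 2(3) by auto
  show ?thesis
  proof (cases "u1 \<le> v2")
    case True
    then have "2 * (P + T) \<le> sched_length s S" using f by (smt (verit))
    then show ?thesis by simp
  next
    case False
    then have "3 * P \<le> sched_length s S" using f by (smt (verit))
    then show ?thesis by simp
  qed
qed

text \<open>The server is at \<open>P\<close>, about \<open>\<Theta> * T\<close>, when it turns to
  two rides that cost at least about \<open>min (2 * \<Theta> + 2) (3 * \<Theta>) * T\<close>. The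
  waiting condition makes the completion time larger than this length by a factor
  \<open>\<Theta> / (\<Theta> - 1)\<close>. An offline server that begins at \<open>-T\<close> needs
  at most \<open>(\<Theta> + 2) * T\<close>.\<close>

lemma waiting_lower_bound:
  assumes "1 \<le> c" "1 < \<Theta>" "smartstart c \<Theta> A"
    and valid: "\<And>\<sigma>. dar_instance \<sigma> \<Longrightarrow> A \<sigma> \<le> \<rho> * Opt c \<sigma>"
  shows "\<Theta> / (\<Theta> - 1) * min (2 * \<Theta> + 2) (3 * \<Theta>) \<le> \<rho> * (\<Theta> + 2)"
proof -
  define \<mu> where "\<mu> = min (2 * \<Theta> + 2) (3 * \<Theta>)"
  obtain n where n: "\<And>m. n \<le> m \<Longrightarrow> 2 / (\<Theta> - 1) \<le> \<Theta> ^ m"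
    using eventually_power_ge[OF assms(2)] by metis
  have "\<Theta> / (\<Theta> - 1) * \<mu> * \<Theta> ^ m - \<Theta> / (\<Theta> - 1) * 3 \<le> \<rho> * ((\<Theta> + 2) * \<Theta> ^ m + 0)"
    if "n \<le> m" for m
  proof -
    define T where "T = \<Theta> ^ m"
    define P where "P = \<Theta> * T - 1"
    \<comment> \<open>Release \<open>T + 1\<close> lies after the start of the trip to
      \<open>P\<close> at time \<open>T\<close> and before its end at time
      \<open>P + 1\<close>.\<close>
    define r1 r2 r3 where "r1 = Request (-T) 0 (T + 1)" and "r2 = Request T P (T + 1)"
      and "r3 = Request P P T"
    define D where "D = insert r3 (bait \<Theta> ` {..<m})"
    define \<sigma> where "\<sigma> = bait \<Theta> ` {..<m} \<union> insert r3 {r1, r2}"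
    have T: "1 \<le> T" "2 \<le> (\<Theta> - 1) * T"
      using assms(2) n[OF that] by (auto simp: T_def field_simps one_le_power)
    have bait_rel: "release r < T" if "r \<in> bait \<Theta> ` {..<m}" for r
      using that assms(2) by (auto simp: T_def power_strict_increasing)
    have P: "T + 1 \<le> P" using T by (simp add: P_def algebra_simps)
    have fin: "finite \<sigma>" by (simp add: \<sigma>_def)
    have inst: "dar_instance \<sigma>"
      using fin assms(2) T by (auto simp: dar_instance_def \<sigma>_def r1_def r2_def r3_def)
    obtain p' where "smartstart_idle c \<Theta> \<sigma> (A \<sigma>) p' \<sigma>"
      using assms(3) inst by (auto simp: smartstart_def)
    from smartstart_idle_reach[OF this]
    have reach: "(ss_step c \<Theta> \<sigma>)\<^sup>*\<^sup>* (P + 1, P, D) (A \<sigma>, p', \<sigma>)"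
      unfolding D_def r3_def T_def
      using T P assms(2) by (intro reach_turning_point[where Q = "{r1, r2}"] assms)
        (auto simp: \<sigma>_def r1_def r2_def r3_def T_def P_def)
    have new: "r1 \<notin> D" "r2 \<notin> D"
      using bait_rel by (fastforce simp: D_def r1_def r2_def r3_def)+
    then have ne: "D \<noteq> \<sigma>" "D \<subseteq> \<sigma>" by (auto simp: \<sigma>_def D_def)
    have lower: "\<Theta> / (\<Theta> - 1) * (\<mu> * T - 3) \<le> A \<sigma>"
    proof -
      obtain S s R where S: "s = start_time c \<Theta> \<sigma> D (P + 1) P" "R = pending \<sigma> D s"
        "shortest_schedule c s P R S"
        "(ss_step c \<Theta> \<sigma>)\<^sup>*\<^sup>* (s + sched_length s S, end_position P S, D \<union> R) (A \<sigma>, p', \<sigma>)"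
        using reach ne(1) by (rule reach_next)
      note sp = start_time_properties[OF assms(1,2) fin ne(2,1), where t = "P + 1" and p = P,
          folded S(1), folded S(2)]
      have R: "R = {r1, r2}"
        using sp(1) P new by (auto simp: S(2) pending_def \<sigma>_def D_def) (auto simp: r1_def r2_def)
      have "D \<union> R = \<sigma>" by (auto simp: R \<sigma>_def D_def)
      then have A: "A \<sigma> = s + sched_length s S" using S(4) reach_done by metis
      have "serves c s P {Request (-T) 0 (T + 1), Request T P (T + 1)} S"
        using S(3) by (simp add: shortest_schedule_def R r1_def r2_def)
      then have "min (2 * (P + T)) (3 * P) \<le> sched_length s S"
        using T P by (intro two_rides_lower_bound) auto
      moreover have "\<mu> * T - 3 \<le> min (2 * (P + T)) (3 * P)"
      proof -
        have "\<mu> * T \<le> (2 * \<Theta> + 2) * T" "\<mu> * T \<le> 3 * \<Theta> * T"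
          using T by (auto simp: \<mu>_def)
        then show ?thesis by (simp add: P_def algebra_simps)
      qed
      ultimately have len: "\<mu> * T - 3 \<le> sched_length s S" by (rule order_trans[rotated])
      have "sched_length s S / (\<Theta> - 1) \<le> s"
        using sp(3) shortest_schedule_L[OF S(3)] assms(2) by (simp add: field_simps)
      then have "\<Theta> / (\<Theta> - 1) * sched_length s S \<le> A \<sigma>"
        using assms(2) unfolding A by (simp add: field_simps)
      moreover have "\<Theta> / (\<Theta> - 1) * (\<mu> * T - 3) \<le> \<Theta> / (\<Theta> - 1) * sched_length s S"
        using len assms(2) by (intro mult_left_mono) auto
      ultimately show ?thesis by linarith
    qed
    have "0 < \<Theta> / (\<Theta> - 1) * (\<mu> * T - 3)"
    proof -
      have "3 < \<mu>" using assms(2) by (simp add: \<mu>_def)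
      then have "\<mu> * 1 \<le> \<mu> * T" using T by (intro mult_left_mono) auto
      then have "0 < \<mu> * T - 3" using \<open>3 < \<mu>\<close> by linarith
      then show ?thesis using assms(2) by simp
    qed
    moreover have "Opt c \<sigma> \<le> (\<Theta> + 2) * T"
    proof -
      \<comment> \<open>The offline server waits at \<open>-T\<close> for \<open>r1\<close>,
        delivers it at 0 at time \<open>2 * T + 1\<close> and serves the rest in one sweep.\<close>
      let ?rs = "map (bait \<Theta>) [0..<m] @ [r2, r3]"
      have "\<sigma> = set (r1 # ?rs)" by (auto simp: \<sigma>_def)
      moreover have "distinct (r1 # ?rs)"
        using new bait_rel[of r3] assms(2) P
        by (auto simp: D_def distinct_map inj_on_def inj_bait r1_def r2_def r3_def)
      moreover have "rightward 0 ?rs P"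
        using P by (intro rightward_append[OF rightward_baits[OF assms(2)]])
          (simp add: r2_def r3_def flip: T_def)
      moreover have "\<forall>r\<in>set ?rs. release r \<le> 2 * T + 1"
        using bait_rel T by (fastforce simp: r2_def r3_def)
      ultimately have "L c 0 0 \<sigma> \<le> 2 * T + 1 + P"
        using L_le_finish[OF assms(1), of "r1 # ?rs" 0 0] finish_rightward[of 0 ?rs P "2 * T + 1"] T
        by (simp add: r1_def)
      then show ?thesis by (simp add: Opt_def P_def algebra_simps)
    qed
    ultimately have "\<Theta> / (\<Theta> - 1) * (\<mu> * T - 3) \<le> \<rho> * ((\<Theta> + 2) * T)"
      by (rule alg_le_mult[OF assms(1) fin order_trans[OF lower valid[OF inst]]])
    then show ?thesis by (simp add: T_def algebra_simps)
  qed
  then have "\<Theta> / (\<Theta> - 1) * \<mu> \<le> \<rho> * (\<Theta> + 2)"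
    by (rule limit_ratio[OF assms(2)])
  then show ?thesis by (simp add: \<mu>_def)
qed


subsubsection \<open>The server does not wait before its last schedule\<close>

text \<open>The ride from \<open>T\<close> to \<open>V\<close> is free on the way to the right, but causes a detour
  on the way back from \<open>X\<close> to \<open>-T\<close>.\<close>

lemma turning_schedule:
  assumes "1 \<le> c" and TPX: "0 < T" "T \<le> V" "V \<le> P" "P \<le> X" "T < X" "V < 3 * T" "X < 2 * P + 3 * T - 2 * V"
    and s: "u \<le> s"
    and S: "shortest_schedule c s P {Request (-T) (-T) u, Request X X u, Request T V u} S"
  shows "sched_length s S = 2 * X - P - T + 2 * V" "end_position P S = - T"
proof -
  let ?l = "Request (-T) (-T) u" and ?x = "Request X X u" and ?v = "Request T V u"
  have serves: "serves c s P {?l, ?x, ?v} S" using S by (simp add: shortest_schedule_def)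
  \<comment> \<open>First \<open>X\<close>, then the ride, then \<open>-T\<close>:
    \<open>(X - P) + (X - T) + (V - T) + (V + T)\<close>.\<close>
  have len: "L c s P (set [?x, ?v, ?l]) \<le> 2 * X - P - T + 2 * V"
    using TPX s by (intro order_trans[OF L_le_finish[OF assms(1)]]) auto
  have "set [?x, ?v, ?l] = {?l, ?x, ?v}" by auto
  then have upper: "sched_length s S \<le> 2 * X - P - T + 2 * V"
    using len shortest_schedule_L[OF S] by simp
  define e where "e = s + sched_length s S"
  obtain r where r: "r \<in> {?l, ?x, ?v}" "(e, Deliver r) \<in> set S" "end_position P S = destination r"
    unfolding e_def by (rule serves_last[OF serves]) auto
  note F = serves_facts[OF serves, folded e_def]
  obtain w where w: "(w, Deliver ?l) \<in> set S"
    by (rule serves_pickup[OF serves, of ?l]) auto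
  obtain y where y: "(y, Deliver ?x) \<in> set S"
    by (rule serves_pickup[OF serves, of ?x]) auto
  obtain a b where ab: "(a, Pickup ?v) \<in> set S" "(b, Deliver ?v) \<in> set S" "a \<le> b"
    by (rule serves_pickup[OF serves, of ?v]) (auto intro: that)
  have f: "s + (P + T) \<le> w" "s + (X - P) \<le> y" "s + (P - T) \<le> a" "X + T \<le> \<bar>w - y\<bar>" "V - T \<le> b - a"
      "X - T \<le> \<bar>y - a\<bar>" "w \<le> e" "y \<le> e" "b \<le> e"
    using F(1)[OF w] F(1)[OF y] F(1)[OF ab(1)] F(3)[OF w y] F(3)[OF ab(1) ab(2)] F(3)[OF y ab(1)] ab(3)
      F(2)[OF w] F(2)[OF y] F(2)[OF ab(2)] TPX by auto
  have "r = ?l \<and> 2 * X - P - T + 2 * V \<le> sched_length s S"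
    using r(1)
  proof (elim insertE emptyE)
    assume r': "r = ?l"
    have g: "X + T \<le> e - y" "V + T \<le> e - b"
      using F(3)[OF r(2) y] F(3)[OF r(2) ab(2)] f r' TPX by auto
    \<comment> \<open>Picking up the ride before visiting \<open>X\<close> costs at least
      \<open>2 * X + P - T\<close>, which is no better because \<open>V \<le> P\<close>.\<close>
    show ?thesis
      using f g TPX r' by (cases "y \<le> a") (auto simp: e_def)
  next
    assume r': "r = ?x"
    \<comment> \<open>Visiting \<open>-T\<close> before \<open>X\<close> takes at least
      \<open>P + 2 * T + X\<close>, too long by the upper bound on \<open>X\<close>.\<close>
    have "X + T \<le> e - w" using F(3)[OF r(2) w] f r' TPX by auto
    then show ?thesis using f TPX upper by (simp add: e_def)
  next
    assume r': "r = ?v"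
    \<comment> \<open>If \<open>X\<close> precedes \<open>-T\<close>, the way from \<open>-T\<close>
      to \<open>V\<close> is too long because \<open>V < 3 * T\<close>.\<close>
    have g: "V + T \<le> e - w" using F(3)[OF r(2) w] f r' TPX by auto
    show ?thesis
      using f g TPX upper by (cases "w \<le> y") (auto simp: e_def)
  qed
  then show "sched_length s S = 2 * X - P - T + 2 * V" "end_position P S = - T"
    using upper r(3) by auto
qed

lemma rightward_from_left:
  "rightward p rs q \<Longrightarrow> rs \<noteq> [] \<Longrightarrow> p' \<le> p \<Longrightarrow> rightward p' rs q"
  by (cases rs) auto

text \<open>In units of \<open>T\<close> and up to constants, \<open>P\<close> is \<pi>, the ride
  ends at \<open>1 + \<kappa>\<close>, and the turning schedule has length \<open>l\<close> and
  starts at \<tau>. Just after this start a last request appears at \<alpha>, so the server, ending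
  at \<open>-1\<close>, still has to travel \<open>\<alpha> + 1\<close>. The offline server leaves
  \<open>-1\<close> at time 1; \<alpha> is chosen so that it passes \<open>X\<close> on its way and
  does not come before the release.\<close>

lemma no_waiting_lower_bound:
  fixes \<Theta> \<pi> \<kappa> :: real
  assumes "1 \<le> c" "1 < \<Theta>" "smartstart c \<Theta> A"
    and valid: "\<And>\<sigma>. dar_instance \<sigma> \<Longrightarrow> A \<sigma> \<le> \<rho> * Opt c \<sigma>"
    and \<pi>: "\<pi> \<le> \<Theta>" "0 \<le> \<kappa>" "1 + \<kappa> < \<pi>" "\<kappa> < 2"
  defines "l \<equiv> 3 * \<pi> + 3 - 2 * \<kappa>"
  defines "\<tau> \<equiv> max \<pi> (l / (\<Theta> - 1))"
  defines "\<alpha> \<equiv> max (2 * \<pi> + 1 - 2 * \<kappa>) (\<tau> - 2)"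
  shows "\<tau> + l + \<alpha> + 1 \<le> \<rho> * (\<alpha> + 2)"
proof -
  obtain n where n: "\<And>m. n \<le> m \<Longrightarrow> 2 / (\<pi> - 1 - \<kappa>) + 2 / (2 - \<kappa>) + 5 \<le> \<Theta> ^ m"
    using eventually_power_ge[OF assms(2)] by metis
  have l: "\<pi> + 2 < l" "2 < \<alpha>" "\<pi> \<le> \<tau>" using \<pi> by (auto simp: l_def \<alpha>_def \<tau>_def)
  have "(\<tau> + l + \<alpha> + 1) * \<Theta> ^ m - (5 + 5 / (\<Theta> - 1)) \<le> \<rho> * ((\<alpha> + 2) * \<Theta> ^ m + 1)"
    if "n \<le> m" for m
  proof -
    define T where "T = \<Theta> ^ m"
    define P where "P = \<pi> * T - 1"
    define V where "V = T + \<kappa> * T"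
    \<comment> \<open>The upper bound on \<open>X\<close> in \<open>turning_schedule\<close>, less a
      margin of 1.\<close>
    define X where "X = 2 * P + 3 * T - 2 * V - 1"
    define l' where "l' = 2 * X - P - T + 2 * V"
    \<comment> \<open>The start of the turning schedule; it falls short of \<open>\<tau> * T\<close>
      by at most \<open>5 / (\<Theta> - 1)\<close>, since \<open>l'\<close> is
      \<open>l * T - 5\<close>.\<close>
    define t2 where "t2 = max (P + 1) (l' / (\<Theta> - 1))"
    define rP rL rX rV rF where "rP = Request P P T" and "rL = Request (-T) (-T) (T + 1)"
      and "rX = Request X X (T + 1)" and "rV = Request T V (T + 1)"
      and "rF = Request (\<alpha> * T) (\<alpha> * T) (\<tau> * T + 1)"
    note rs_def = rP_def rL_def rX_def rV_def rF_def
    define D where "D = insert rP (bait \<Theta> ` {..<m})"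
    define \<sigma> where "\<sigma> = bait \<Theta> ` {..<m} \<union> insert rP {rL, rX, rV, rF}"
    have "0 < 2 / (\<pi> - 1 - \<kappa>)" "0 < 2 / (2 - \<kappa>)" using \<pi> by auto
    then have T0: "5 \<le> T" "2 / (\<pi> - 1 - \<kappa>) \<le> T" "2 / (2 - \<kappa>) \<le> T"
      using n[OF that] unfolding T_def by linarith+
    then have T: "2 \<le> (\<pi> - 1 - \<kappa>) * T" "2 \<le> (2 - \<kappa>) * T"
      using \<pi> by (simp_all add: field_simps)
    have \<kappa>T: "0 \<le> \<kappa> * T" using \<pi> T0 by simp
    have V: "T \<le> V" "V + 1 \<le> P" "V + 2 \<le> 3 * T"
      using T \<kappa>T by (auto simp: V_def P_def algebra_simps)
    have X: "P \<le> X" "X = (2 * \<pi> + 1 - 2 * \<kappa>) * T - 3"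
      using V by (auto simp: X_def V_def P_def algebra_simps)
    have l': "l' = l * T - 5" by (simp add: l'_def l_def X_def V_def P_def algebra_simps)
    have \<alpha>T: "(2 * \<pi> + 1 - 2 * \<kappa>) * T \<le> \<alpha> * T" "(\<tau> - 2) * T \<le> \<alpha> * T"
      using T0 by (intro mult_right_mono; simp add: \<alpha>_def)+
    then have XF: "X \<le> \<alpha> * T" using X by simp
    have \<tau>T: "\<pi> * T \<le> \<tau> * T" "l / (\<Theta> - 1) * T \<le> \<tau> * T"
      using T0 by (intro mult_right_mono; simp add: \<tau>_def)+
    have t2: "P + 1 \<le> t2" "l' \<le> (\<Theta> - 1) * t2" "t2 \<le> \<tau> * T" "\<tau> * T - 5 / (\<Theta> - 1) \<le> t2"
    proof -
      show "P + 1 \<le> t2" by (simp add: t2_def)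
      have "l' / (\<Theta> - 1) \<le> t2" by (simp add: t2_def)
      then show "l' \<le> (\<Theta> - 1) * t2" using assms(2) by (simp add: field_simps)
      have eq: "l' / (\<Theta> - 1) = l / (\<Theta> - 1) * T - 5 / (\<Theta> - 1)"
        by (simp add: l' diff_divide_distrib)
      have pos: "0 \<le> 5 / (\<Theta> - 1)" using assms(2) by simp
      then have "l' / (\<Theta> - 1) \<le> \<tau> * T" using \<tau>T(2) eq by linarith
      then show "t2 \<le> \<tau> * T" using \<tau>T(1) by (simp add: t2_def P_def)
      have "\<pi> * T \<le> t2" "l / (\<Theta> - 1) * T - 5 / (\<Theta> - 1) \<le> t2"
        unfolding eq[symmetric] by (auto simp: t2_def P_def)
      moreover from this pos have "\<pi> * T - 5 / (\<Theta> - 1) \<le> t2" by linarith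
      ultimately show "\<tau> * T - 5 / (\<Theta> - 1) \<le> t2"
        by (cases "\<tau> = \<pi>") (auto simp: \<tau>_def max_def split: if_splits)
    qed
    have bait_rel: "release r < T" if "r \<in> bait \<Theta> ` {..<m}" for r
      using that assms(2) by (auto simp: T_def power_strict_increasing)
    have fin: "finite \<sigma>" by (simp add: \<sigma>_def)
    have \<tau>P: "P + 1 \<le> \<tau> * T" using t2 by simp
    have inst: "dar_instance \<sigma>"
      using fin assms(2) T0 \<tau>P V by (auto simp: dar_instance_def \<sigma>_def rs_def)
    obtain p' where "smartstart_idle c \<Theta> \<sigma> (A \<sigma>) p' \<sigma>"
      using assms(3) inst by (auto simp: smartstart_def)
    from smartstart_idle_reach[OF this]
    have reach: "(ss_step c \<Theta> \<sigma>)\<^sup>*\<^sup>* (P + 1, P, D) (A \<sigma>, p', \<sigma>)"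
      unfolding D_def rP_def T_def
    proof (rule reach_turning_point[where Q = "{rL, rX, rV, rF}", OF _ assms(1,2)])
      show "\<sigma> = bait \<Theta> ` {..<m} \<union> insert (Request P P (\<Theta> ^ m)) {rL, rX, rV, rF}"
        by (simp add: \<sigma>_def rP_def T_def)
      show "\<Theta> ^ m < release r" if "r \<in> {rL, rX, rV, rF}" for r
        using that \<tau>P V T0 by (auto simp: rs_def T_def)
      show "\<Theta> ^ m - 1 \<le> P" using V by (simp add: T_def)
      have "\<pi> * T \<le> \<Theta> * T" using \<pi>(1) T0 by (intro mult_right_mono) auto
      then show "P \<le> \<Theta> ^ Suc m - 1" by (simp add: P_def T_def)
    qed simp
    have new: "rL \<notin> D" "rX \<notin> D" "rV \<notin> D" "rF \<notin> D"
      using bait_rel \<tau>P V T0 by (fastforce simp: D_def rs_def)+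
    have rF: "rF \<notin> {rL, rX, rV}" using \<tau>P V T0 by (auto simp: rs_def)
    have ne: "D \<noteq> \<sigma>" "D \<subseteq> \<sigma>" using new by (auto simp: \<sigma>_def D_def)
    have A: "0 < A \<sigma>" "(\<tau> + l + \<alpha> + 1) * T - (5 + 5 / (\<Theta> - 1)) \<le> A \<sigma>"
    proof -
      obtain S s R where S: "s = start_time c \<Theta> \<sigma> D (P + 1) P" "R = pending \<sigma> D s"
        "shortest_schedule c s P R S"
        "(ss_step c \<Theta> \<sigma>)\<^sup>*\<^sup>* (s + sched_length s S, end_position P S, D \<union> R) (A \<sigma>, p', \<sigma>)"
        using reach ne(1) by (rule reach_next)
      note sp = start_time_properties[OF assms(1,2) fin ne(2,1), where t = "P + 1" and p = P,
          folded S(1), folded S(2)]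
      have pend: "pending \<sigma> D s' = {rL, rX, rV}" if "P + 1 \<le> s'" "s' \<le> t2" for s'
      proof -
        have "release rL \<le> s'" "release rX \<le> s'" "release rV \<le> s'" "s' < release rF"
          using that V t2 by (auto simp: rs_def)
        then show ?thesis using new by (auto simp: pending_def \<sigma>_def D_def)
      qed
      have turn: "sched_length s' S' = l'" "end_position P S' = - T"
        if "P + 1 \<le> s'" "shortest_schedule c s' P {rL, rX, rV} S'" for s' S'
        using turning_schedule[OF assms(1), of T V P X "T + 1" s' S'] that V X T0
        by (auto simp: rs_def l'_def) (auto simp: X_def)
      have len: "L c s' P {rL, rX, rV} = l'" if "P + 1 \<le> s'" for s'
        using shortest_schedule_exists[OF assms(1), of "{rL, rX, rV}" s' P] turn(1)[OF that]
          shortest_schedule_L by force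
      \<comment> \<open>Up to \<open>t2\<close> the request \<open>rF\<close> is unknown and the
        length stays \<open>l'\<close>, so the start is exactly \<open>t2\<close>.\<close>
      have "s \<le> t2" using sp(5)[of t2] pend[of t2] len t2 by simp
      then have R: "R = {rL, rX, rV}" using pend sp(1) S(2) by simp
      have "l' \<le> (\<Theta> - 1) * s" using sp(1,3) len R by simp
      then have "t2 \<le> s" using sp(1) assms(2) by (simp add: t2_def field_simps)
      then have s: "s = t2" using \<open>s \<le> t2\<close> by simp
      have reach2: "(ss_step c \<Theta> \<sigma>)\<^sup>*\<^sup>* (t2 + l', - T, D \<union> {rL, rX, rV}) (A \<sigma>, p', \<sigma>)"
        using S(3,4) turn[of s S] sp(1) R s by simp
      have ne': "D \<union> {rL, rX, rV} \<noteq> \<sigma>" "D \<union> {rL, rX, rV} \<subseteq> \<sigma>"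
        using rF new ne by (auto simp: \<sigma>_def)
      obtain S2 s2 R2 where S2: "s2 = start_time c \<Theta> \<sigma> (D \<union> {rL, rX, rV}) (t2 + l') (- T)"
        "R2 = pending \<sigma> (D \<union> {rL, rX, rV}) s2" "shortest_schedule c s2 (- T) R2 S2"
        "(ss_step c \<Theta> \<sigma>)\<^sup>*\<^sup>* (s2 + sched_length s2 S2, end_position (- T) S2,
          D \<union> {rL, rX, rV} \<union> R2) (A \<sigma>, p', \<sigma>)"
        using reach2 ne'(1) by (rule reach_next)
      note sp2 = start_time_properties[OF assms(1,2) fin ne'(2,1), where t = "t2 + l'" and p = "- T",
          folded S2(1), folded S2(2)]
      have R2: "R2 = {rF}" using sp2(2) by (auto simp: S2(2) pending_def \<sigma>_def D_def)
      have "D \<union> {rL, rX, rV} \<union> R2 = \<sigma>" by (auto simp: R2 \<sigma>_def D_def)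
      then have "A \<sigma> = s2 + sched_length s2 S2" using S2(4) reach_done by metis
      moreover have "\<alpha> * T + T \<le> sched_length s2 S2"
        using serves_single(1)[of c s2 "- T" rF S2] S2(3)
        by (auto simp: R2 shortest_schedule_def) (auto simp: rF_def)
      ultimately have "t2 + l' + \<alpha> * T + T \<le> A \<sigma>" using sp2(1) by simp
      moreover have "0 < t2 + l' + \<alpha> * T + T"
        using t2(1) V X T0 XF by (simp add: l'_def)
      ultimately show "0 < A \<sigma>" "(\<tau> + l + \<alpha> + 1) * T - (5 + 5 / (\<Theta> - 1)) \<le> A \<sigma>"
        using t2(4) by (auto simp: l' algebra_simps)
    qed
    have "Opt c \<sigma> \<le> (\<alpha> + 2) * T + 1"
    proof -
      \<comment> \<open>Offline: wait at \<open>-T\<close> until \<open>T + 1\<close>, sweep to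
        \<open>X\<close> and go on to \<open>\<alpha> * T\<close>. Arrival and release of
        \<open>rF\<close> are both at most \<open>(\<alpha> + 2) * T + 1\<close>.\<close>
      let ?rs = "map (bait \<Theta>) [0..<m] @ [rV, rP, rX]"
      have "\<sigma> = set (rL # ?rs @ [rF])" by (auto simp: \<sigma>_def)
      moreover have "distinct (rL # ?rs @ [rF])"
      proof -
        have "distinct (map (bait \<Theta>) [0..<m])"
          using assms(2) by (simp add: distinct_map inj_on_def inj_bait)
        moreover have "rP \<notin> bait \<Theta> ` {..<m}" using bait_rel[of rP] by (auto simp: rP_def)
        moreover have "rV \<noteq> rX" "rL \<noteq> rV" "rL \<noteq> rX" using V X T0 by (auto simp: rs_def)
        ultimately show ?thesis using new rF unfolding D_def
          by (simp add: atLeast0LessThan) blast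
      qed
      moreover have "rightward (- T) ?rs X"
      proof (rule rightward_from_left)
        show "rightward 0 ?rs X"
          using V X by (intro rightward_append[OF rightward_baits[OF assms(2)]])
            (simp add: rs_def flip: T_def)
      qed (use T0 in auto)
      moreover have "\<forall>r\<in>set ?rs. release r \<le> T + 1"
        using bait_rel by (fastforce simp: rs_def)
      ultimately have "L c 0 0 \<sigma> \<le> finish 0 0 (rL # ?rs @ [rF])"
        and sweep: "finish (T + 1) (- T) ?rs = T + 1 + (X + T)"
        using L_le_finish[OF assms(1), of "rL # ?rs @ [rF]" 0 0]
          finish_rightward[of "- T" ?rs X "T + 1"] by simp_all
      moreover have "finish 0 0 (rL # ?rs @ [rF]) = finish (T + 1) (- T) (?rs @ [rF])"
        using T0 by (simp add: rL_def)
      moreover have "finish (T + 1) (- T) (?rs @ [rF]) = finish (T + 1 + (X + T)) X [rF]"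
        unfolding finish_append[of _ _ ?rs] sweep by (simp add: rX_def)
      ultimately have "L c 0 0 \<sigma> \<le> max (T + 1 + (X + T) + \<bar>\<alpha> * T - X\<bar>) (\<tau> * T + 1)"
        by (simp add: rF_def)
      then show ?thesis using XF \<alpha>T by (auto simp add: Opt_def algebra_simps)
    qed
    then have "A \<sigma> \<le> \<rho> * ((\<alpha> + 2) * T + 1)"
      by (rule alg_le_mult[OF assms(1) fin valid[OF inst] A(1)])
    then show ?thesis using A(2) by (simp add: T_def)
  qed
  then show ?thesis by (rule limit_ratio[OF assms(2)])
qed

subsection \<open>The two bounding functions\<close>

text \<open>Splitting off the constant 2 makes the decrease for \<open>x > 1\<close>
  visible.\<close>

lemma f1_eq: "f1 x = 2 + 4 / ((x - 1) * (x + 2))" if "1 < x"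
proof -
  have "(x - 1) * (x + 2) = x\<^sup>2 + x - 2" by (simp add: power2_eq_square algebra_simps)
  moreover have "0 < (x - 1) * (x + 2)" using that by simp
  ultimately show ?thesis by (simp add: f1_def field_simps)
qed

lemma f2_eq: "f2 x = x + 2 / 3 + 2 / (3 * x + 3)" if "0 < x"
  using that by (simp add: f2_def field_simps)

lemma f1_strict_decreasing:
  assumes "1 < x" "x < y"
  shows "f1 y < f1 x"
proof -
  have "0 < (x - 1) * (x + 2)" "(x - 1) * (x + 2) < (y - 1) * (y + 2)"
    using assms by (auto intro!: mult_strict_mono)
  then have "4 / ((y - 1) * (y + 2)) < 4 / ((x - 1) * (x + 2))"
    by (intro divide_strict_left_mono) auto
  then show ?thesis using assms by (simp add: f1_eq)
qed

text \<open>The decreasing summand in \<open>f2_eq\<close> falls more slowly than \<open>x\<close>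
  grows, as the factored difference shows.\<close>

lemma f2_strict_increasing:
  assumes "0 < x" "x < y"
  shows "f2 x < f2 y"
proof -
  have "1 * 1 < (x + 1) * (y + 1)" using assms by (intro mult_strict_mono) auto
  then have "0 < (y - x) * (3 * ((x + 1) * (y + 1)) - 2)" using assms by (intro mult_pos_pos) auto
  moreover have "f2 y - f2 x = (y - x) * (3 * ((x + 1) * (y + 1)) - 2) / (3 * ((x + 1) * (y + 1)))"
    using assms by (simp add: f2_eq divide_simps) (simp add: algebra_simps)
  ultimately have "0 < f2 y - f2 x" using assms by simp
  then show ?thesis by simp
qed

lemma f1_eq_f2_imp_gt_1:
  assumes "0 < x" "f1 x = f2 x"
  shows "1 < x"
proof (rule ccontr)
  assume "\<not> 1 < x"
  then consider "x = 1" | "x < 1" by linarith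
  then show False
  proof cases
    case 1
    \<comment> \<open>Division by zero gives \<open>f1 1 = 0\<close>, whereas
      \<open>f2 1 = 2\<close>.\<close>
    then show False using assms(2) by (simp add: f1_def f2_def)
  next
    case 2
    have "x\<^sup>2 < 1" using assms(1) 2 by (simp add: power_less_one_iff)
    then have "f1 x \<le> 0" using assms(1) 2 unfolding f1_def by (intro divide_nonneg_nonpos) auto
    moreover have "0 < f2 x" using assms(1) by (simp add: f2_eq add_pos_pos)
    ultimately show False using assms(2) by simp
  qed
qed

lemma f1_eq_f2_unique:
  assumes "0 < x" "f1 x = f2 x" "0 < y" "f1 y = f2 y"
  shows "x = y"
  using f1_strict_decreasing[of x y] f1_strict_decreasing[of y x]
    f2_strict_increasing[of x y] f2_strict_increasing[of y x]
    f1_eq_f2_imp_gt_1[of x] f1_eq_f2_imp_gt_1[of y] assms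
  by (cases x y rule: linorder_cases) auto

text \<open>\<open>f2 - f1\<close> changes sign between two points close enough to fix the required
  digits of \<open>theta_star\<close> and \<open>rho_star\<close>.\<close>

lemma theta_exists: "\<exists>x. 2.052618 \<le> x \<and> x \<le> 2.052619 \<and> f1 x = f2 x"
proof -
  have "\<exists>x\<ge>2.052618. x \<le> 2.052619 \<and> f2 x - f1 x = 0"
  proof (rule IVT')
    show "f2 2.052618 - f1 2.052618 \<le> 0" by (simp add: f1_def f2_def power2_eq_square)
    show "0 \<le> f2 2.052619 - f1 2.052619" by (simp add: f1_def f2_def power2_eq_square)
    have "continuous_on {2.052618..2.052619}
        (\<lambda>x::real. (x + 2 / 3 + 2 / (3 * x + 3)) - (2 + 4 / ((x - 1) * (x + 2))))"
      by (intro continuous_intros) auto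
    then show "continuous_on {2.052618..2.052619} (\<lambda>x. f2 x - f1 x)"
      by (subst continuous_on_cong[OF refl]) (auto simp: f1_eq f2_eq)
  qed simp
  then show ?thesis by auto
qed

lemma theta_star_props:
  shows "2.052618 \<le> theta_star" "theta_star \<le> 2.052619" "f1 theta_star = f2 theta_star"
proof -
  obtain x where x: "2.052618 \<le> x" "x \<le> 2.052619" "f1 x = f2 x" using theta_exists by blast
  then have "theta_star = x"
    unfolding theta_star_def using f1_eq_f2_unique by (intro the_equality) auto
  then show "2.052618 \<le> theta_star" "theta_star \<le> 2.052619" "f1 theta_star = f2 theta_star"
    using x by auto
qed

lemma rho_star_bounds: "2.937675 < rho_star" "rho_star < 2.937685"
proof -
  have mono: "f1 y \<le> f1 x" if "1 < x" "x \<le> y" for x y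
    using f1_strict_decreasing[of x y] that by (cases "x = y") auto
  have "f1 2.052619 \<le> rho_star" "rho_star \<le> f1 2.052618"
    unfolding rho_star_def using theta_star_props(1,2) by (auto intro!: mono)
  moreover have "2.937675 < f1 2.052619" "f1 2.052618 < 2.937685"
    by (simp_all add: f1_def power2_eq_square)
  ultimately show "2.937675 < rho_star" "rho_star < 2.937685" by linarith+
qed

section \<open>The competitive ratio at and away from \<open>theta_star\<close>\<close>

lemma competitive_ratio_theta_star_le:
  assumes "1 \<le> c" "smartstart c theta_star A"
  shows "competitive_ratio c A \<le> ereal rho_star"
proof (rule competitive_ratio_le)
  fix \<sigma> assume \<sigma>: "dar_instance \<sigma>"
  then obtain p where p: "smartstart_idle c theta_star \<sigma> (A \<sigma>) p \<sigma>"
    using assms(2) by (auto simp: smartstart_def)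
  let ?\<Theta> = theta_star and ?\<delta> = "(theta_star - 1) / (3 * theta_star + 3)"
  note b = theta_star_props(1,2) rho_star_bounds
  show "A \<sigma> \<le> rho_star * Opt c \<sigma>"
  proof (rule smartstart_upper_bound[OF assms(1) _ _ _ _ _ _ \<sigma> p])
    have "?\<delta> * (3 * ?\<Theta> + 3) = ?\<Theta> - 1" using b by simp
    then show "3 * (?\<Theta> * ?\<delta>) + 3 * ?\<delta> = ?\<Theta> - 1" by (simp only: algebra_simps)
    have "0 < (?\<Theta> - 1) * (?\<Theta> + 2)" using b by simp
    then show "2 * ?\<Theta> * (?\<Theta> + 1) \<le> rho_star * ((?\<Theta> + 2) * (?\<Theta> - 1))"
      using b by (simp add: rho_star_def f1_eq field_simps)
    show "?\<Theta> + 1 - ?\<delta> \<le> rho_star"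
      using theta_star_props(3) by (simp add: rho_star_def f2_def)
  qed (use b in auto)
qed

text \<open>For \<open>\<Theta> < 2\<close> the order of cost \<open>3 * \<Theta>\<close> is the
  cheaper one and yields only 3, which still exceeds \<open>rho_star\<close>.\<close>

lemma competitive_ratio_ge_f1:
  assumes "1 \<le> c" "1 < \<Theta>" "smartstart c \<Theta> A"
  shows "ereal (min (f1 \<Theta>) 3) \<le> competitive_ratio c A"
proof (rule le_competitive_ratio)
  fix \<rho> assume "\<And>\<sigma>. dar_instance \<sigma> \<Longrightarrow> A \<sigma> \<le> \<rho> * Opt c \<sigma>"
  then have "\<Theta> / (\<Theta> - 1) * min (2 * \<Theta> + 2) (3 * \<Theta>) \<le> \<rho> * (\<Theta> + 2)"
    by (rule waiting_lower_bound[OF assms])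
  then have main: "\<Theta> * min (2 * \<Theta> + 2) (3 * \<Theta>) \<le> \<rho> * ((\<Theta> - 1) * (\<Theta> + 2))"
    using assms(2) by (simp add: divide_simps mult_ac)
  have pos: "0 < (\<Theta> - 1) * (\<Theta> + 2)" using assms(2) by simp
  show "min (f1 \<Theta>) 3 \<le> \<rho>"
  proof (cases "\<Theta> < 2")
    case True
    then have "3 * ((\<Theta> - 1) * (\<Theta> + 2)) \<le> \<rho> * ((\<Theta> - 1) * (\<Theta> + 2))"
      using main by (simp add: algebra_simps min_def)
    then have "3 \<le> \<rho>" using pos by (simp only: mult_le_cancel_right_pos)
    then show ?thesis by simp
  next
    case False
    then have "\<Theta> * (2 * \<Theta> + 2) \<le> \<rho> * ((\<Theta> - 1) * (\<Theta> + 2))"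
      using main by (simp add: min_def split: if_splits)
    moreover have "f1 \<Theta> = \<Theta> * (2 * \<Theta> + 2) / ((\<Theta> - 1) * (\<Theta> + 2))"
      by (simp add: f1_def power2_eq_square algebra_simps)
    ultimately have "f1 \<Theta> \<le> \<rho>" using pos by (simp add: pos_divide_le_eq)
    then show ?thesis by simp
  qed
qed

text \<open>With \<open>\<pi> = \<Theta>\<close> and \<open>\<kappa> = 0\<close> the bound is
  \<open>f2 \<Theta>\<close> as long as \<open>\<tau> - 2\<close> determines \<alpha>. Beyond 2.8, a
  positive \<kappa> helps: at fixed \<tau> and as long as \<open>\<tau> - 2\<close> does not
  determine \<alpha>, it takes \<open>2 * \<kappa>\<close> off both \<open>l\<close> and \<alpha>,
  which raises a ratio above 2. The cap 2.94 is just above \<open>rho_star\<close>.\<close>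

lemma competitive_ratio_ge_f2:
  assumes "1 \<le> c" "2 < \<Theta>" "smartstart c \<Theta> A"
  shows "ereal (min (f2 \<Theta>) 2.94) \<le> competitive_ratio c A"
proof (rule le_competitive_ratio)
  fix \<rho> assume valid: "\<And>\<sigma>. dar_instance \<sigma> \<Longrightarrow> A \<sigma> \<le> \<rho> * Opt c \<sigma>"
  have \<Theta>: "1 < \<Theta>" using assms(2) by simp
  note bound = no_waiting_lower_bound[OF assms(1) \<Theta> assms(3) valid]
  consider "\<Theta> \<le> 2.8" | "2.8 < \<Theta>" "\<Theta> \<le> 3" | "3 < \<Theta>" by linarith
  then show "min (f2 \<Theta>) 2.94 \<le> \<rho>"
  proof cases
    case 1
    define \<tau> where "\<tau> = (3 * \<Theta> + 3) / (\<Theta> - 1)"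
    have \<tau>: "\<tau> * (\<Theta> - 1) = 3 * \<Theta> + 3" using \<Theta> by (simp add: \<tau>_def)
    have sq: "\<Theta> * \<Theta> \<le> 14 / 5 * \<Theta>" using 1 \<Theta> by (intro mult_right_mono) auto
    \<comment> \<open>The left side is
      \<open>2.94 * (2 * \<Theta> + 3) - (5 * \<Theta> + 5)\<close>, which is what the case
      \<open>\<alpha> = 2 * \<Theta> + 1\<close> requires of \<tau>.\<close>
    have ge: "22 / 25 * \<Theta> + 191 / 50 \<le> \<tau>"
    proof -
      have "(22 / 25 * \<Theta> + 191 / 50) * (\<Theta> - 1) = 22 / 25 * (\<Theta> * \<Theta>) + 147 / 50 * \<Theta> - 191 / 50"
        by (simp add: field_simps)
      then have "(22 / 25 * \<Theta> + 191 / 50) * (\<Theta> - 1) \<le> 3 * \<Theta> + 3" using sq 1 by simp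
      then show ?thesis using \<Theta> by (simp add: \<tau>_def pos_le_divide_eq)
    qed
    then have "max \<Theta> \<tau> = \<tau>" using 1 \<Theta> by simp
    then have b: "\<tau> + (3 * \<Theta> + 3) + max (2 * \<Theta> + 1) (\<tau> - 2) + 1 \<le> \<rho> * (max (2 * \<Theta> + 1) (\<tau> - 2) + 2)"
      using bound[of \<Theta> 0] \<Theta> by (simp add: \<tau>_def)
    show ?thesis
    proof (cases "2 * \<Theta> + 1 \<le> \<tau> - 2")
      case True
      have "0 < \<tau>" using ge \<Theta> by simp
      have f2: "f2 \<Theta> = \<Theta> + 1 - 1 / \<tau>" using \<Theta> by (simp add: f2_def \<tau>_def)
      have "f2 \<Theta> * \<tau> = \<tau> * (\<Theta> - 1) + 2 * \<tau> - 1"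
        unfolding f2 using \<open>0 < \<tau>\<close> by (simp add: field_simps)
      also have "\<dots> \<le> \<rho> * \<tau>" unfolding \<tau> using b True by (simp add: max_def)
      finally have "f2 \<Theta> \<le> \<rho>" using \<open>0 < \<tau>\<close> by simp
      then show ?thesis by simp
    next
      case False
      define x where "x = \<rho> * (2 * \<Theta> + 3)"
      have "\<tau> + 5 * \<Theta> + 5 \<le> x"
        using b False by (simp add: max_def x_def add.commute[of 3])
      then have "147 / 50 * (2 * \<Theta> + 3) \<le> x" using ge by simp
      then have "147 / 50 \<le> \<rho>" unfolding x_def using \<Theta> by (subst (asm) mult_le_cancel_right_pos) auto
      then show ?thesis by simp
    qed
  next
    case 2
    \<comment> \<open>\<open>\<pi> = 2.8\<close> and \<open>\<kappa> = 1.7\<close> give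
      \<open>l = 8\<close> and \<open>\<alpha> = 3.2\<close>.\<close>
    define \<tau> where "\<tau> = max 2.8 (8 / (\<Theta> - 1))"
    have "4 \<le> 8 / (\<Theta> - 1)" "8 / (\<Theta> - 1) \<le> 5" using 2 by (simp_all add: field_simps)
    then have \<tau>: "4 \<le> \<tau>" "\<tau> \<le> 5" by (simp_all add: \<tau>_def)
    have "\<tau> + 8 + max 3.2 (\<tau> - 2) + 1 \<le> \<rho> * (max 3.2 (\<tau> - 2) + 2)"
      using bound[of "2.8" "1.7"] 2 unfolding \<tau>_def by simp
    moreover have "max 3.2 (\<tau> - 2) = 3.2" using \<tau> by simp
    ultimately show ?thesis using \<tau> by simp
  next
    case 3
    \<comment> \<open>\<open>\<pi> = 3\<close> and \<open>\<kappa> = 1.9\<close> give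
      \<open>l = 8.2\<close> and \<open>\<alpha> = 3.2\<close>; then \<open>\<tau> \<ge> 3\<close>
      is enough, however large \<Theta> is.\<close>
    define \<tau> where "\<tau> = max 3 (8.2 / (\<Theta> - 1))"
    have "8.2 / (\<Theta> - 1) \<le> 5" using 3 by (simp add: field_simps)
    then have \<tau>: "3 \<le> \<tau>" "\<tau> \<le> 5" by (simp_all add: \<tau>_def)
    have "\<tau> + 8.2 + max 3.2 (\<tau> - 2) + 1 \<le> \<rho> * (max 3.2 (\<tau> - 2) + 2)"
      using bound[of 3 "1.9"] 3 unfolding \<tau>_def by simp
    moreover have "max 3.2 (\<tau> - 2) = 3.2" using \<tau> by simp
    ultimately show ?thesis using \<tau> by simp
  qed
qed

theorem theorem4p9:
  fixes c :: enat
  assumes "1 \<le> c"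
  shows "(\<exists>!\<Theta>. 0 < \<Theta> \<and> f1 \<Theta> = f2 \<Theta>)
    \<and> \<bar>theta_star - 2.0526\<bar> < 0.00005
    \<and> rho_star = f2 theta_star
    \<and> \<bar>rho_star - 2.93768\<bar> < 0.000005
    \<and> (\<forall>\<Theta>>1. \<exists>A. smartstart c \<Theta> A)
    \<and> (\<forall>A. smartstart c theta_star A \<longrightarrow> competitive_ratio c A = ereal rho_star)
    \<and> (\<forall>\<Theta> A. 1 < \<Theta> \<and> \<Theta> \<noteq> theta_star \<and> smartstart c \<Theta> A
          \<longrightarrow> ereal rho_star < competitive_ratio c A)"
proof (intro conjI allI impI)
  note b = theta_star_props rho_star_bounds
  show "\<exists>!\<Theta>. 0 < \<Theta> \<and> f1 \<Theta> = f2 \<Theta>"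
    using b f1_eq_f2_unique by (intro ex1I[of _ theta_star]) auto
  show "\<bar>theta_star - 2.0526\<bar> < 0.00005" "\<bar>rho_star - 2.93768\<bar> < 0.000005"
    using b unfolding abs_less_iff by auto
  show "rho_star = f2 theta_star" using b by (simp add: rho_star_def)
  show "\<exists>A. smartstart c \<Theta> A" if "1 < \<Theta>" for \<Theta> using smartstart_exists[OF assms that] .
  show "competitive_ratio c A = ereal rho_star" if "smartstart c theta_star A" for A
  proof (rule antisym)
    show "competitive_ratio c A \<le> ereal rho_star"
      using competitive_ratio_theta_star_le[OF assms that] .
    have "min (f1 theta_star) 3 = rho_star" using b by (simp add: rho_star_def)
    then show "ereal rho_star \<le> competitive_ratio c A"
      using competitive_ratio_ge_f1[OF assms _ that] b by simp
  qed
  show "ereal rho_star < competitive_ratio c A"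
    if "1 < \<Theta> \<and> \<Theta> \<noteq> theta_star \<and> smartstart c \<Theta> A" for \<Theta> A
  \<comment> \<open>To the left of \<open>theta_star\<close> the decreasing \<open>f1\<close>
    exceeds \<open>rho_star\<close>, to the right the increasing \<open>f2\<close> does, and so do
    the caps 3 and 2.94.\<close>
  proof (cases "\<Theta> < theta_star")
    case True
    then have "ereal rho_star < ereal (min (f1 \<Theta>) 3)"
      using f1_strict_decreasing[of \<Theta> theta_star] that b by (simp add: rho_star_def)
    also have "\<dots> \<le> competitive_ratio c A"
      using competitive_ratio_ge_f1[OF assms] that by blast
    finally show ?thesis .
  next
    case False
    then have "theta_star < \<Theta>" using that by simp
    then have "ereal rho_star < ereal (min (f2 \<Theta>) 2.94)"
      using f2_strict_increasing[of theta_star \<Theta>] b by (simp add: rho_star_def)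
    also have "\<dots> \<le> competitive_ratio c A"
      using competitive_ratio_ge_f2[OF assms, of \<Theta>] that \<open>theta_star < \<Theta>\<close> b by simp
    finally show ?thesis .
  qed
qed

end
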